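(* Let $\mathfrak G_1,\mathfrak G_2$ be groupoid crossed modules and let $\mathcal M\rightrightarrows\mathcal M^0$ be a crossing from $\mathfrak G_1$ to $\mathfrak G_2$. Then there exist a third groupoid crossed module $\mathfrak G'$ and a zig-zag of strict morphisms of crossed modules $$\mathfrak G_1\longleftarrow \mathfrak G'\longrightarrow\mathfrak G_2$$ such that the leftward arrow is a hypercover. In other words, $\mathcal M$ induces a weak homomorphism from the topological $2$-groupoid associated to $\mathfrak G_1$ to the topological $2$-groupoid associated to $\mathfrak G_2$.
   Context: **Groupoids and crossed modules.** In a topological groupoid $\mathcal G\rightrightarrows\mathcal G^0$ an arrow $g:x\to y$ has source $s(g)=x$, target $t(g)=y$; $gf$ is defined when $s(g)=t(f)$; units are identified with identity arrows. Strict morphisms of topological groupoids are continuous functors. A bundle of topological groups over $X$ is a topological groupoid $\mathcal H\rightrightarrows X$ with $s=t$; its fibre at $x$ is $\mathcal H^x$. An action by automorphisms of $\mathcal G\rightrightarrows X$ on $\mathcal H\to X$ assigns to each $g:x\to y$ an isomorphism of topological groups $\mathcal H^y\to\mathcal H^x$, $h\mapsto h^g$, continuous in $(h,g)$, with $h^{gf}=(h^g)^f$ and $h^{1_x}=h$. A groupoid crossed module $\mathfrak G=(\mathcal H\xrightarrow{\partial}\mathcal G)$ with unit space $X$ consists of a topological groupoid $\mathcal G\rightrightarrows X$, a bundle of topological groups $\mathcal H\to X$, a strict morphism $\partial:\mathcal H\to\mathcal G$ that is the identity on $X$, and an action by automorphisms of $\mathcal G$ on $\mathcal H$ such that $\partial(h^g)=g^{-1}\partial(h)g$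 for $h\in\mathcal H^{t(g)}$ and $k^{\partial(h)}=h^{-1}kh$ for $h,k$ in the same fibre. A strict morphism $\chi:\mathfrak G_1\to\mathfrak G_2$ is a pair of strict groupoid morphisms $\mathcal H_1\to\mathcal H_2$, $\mathcal G_1\to\mathcal G_2$ (both written $\chi$, inducing the same map on unit spaces) with $\chi\partial_1=\partial_2\chi$ and $\chi(h^g)=\chi(h)^{\chi(g)}$. **Pullbacks.** For $\sigma:Z\to\mathcal G^0$ continuous, $\mathcal G[Z]=\{(z_1,g,z_2)\in Z\times\mathcal G\times Z:\sigma(z_1)=t(g),\ s(g)=\sigma(z_2)\}$ is a groupoid over $Z$ with target $z_1$, source $z_2$, product $(z_1,g,z_2)(z_2,f,z_3)=(z_1,gf,z_3)$. Put $\mathcal H[Z]=\{(z,h)\in Z\times\mathcal H: h\in\mathcal H^{\sigma(z)}\}$. The pullback crossed module $\mathfrak G[Z]=\sigma^*\mathfrak G$ is $\sigma^*\partial:\mathcal H[Z]\to\mathcal G[Z]$, $(z,h)\mapsto(z,\partial(h),z)$, with action $(z_1,h)^{(z_1,g,z_2)}=(z_2,h^g)$. **Crossings.** Let $\mathfrak G_i=(\mathcal H_i\xrightarrow{\partial_i}\mathcal G_i)$, $i=1,2$, have unit spaces $X_i$. A crossing from $\mathfrak G_1$ to $\mathfrak G_2$ is a topological groupoid $\mathcal M\rightrightarrows\mathcal M^0$ with continuous maps $X_1\xleftarrow{\tau}\mathcal M^0\xrightarrow{\sigma}X_2$ and strict morphisms, identity on $\mathcal M^0$, $\alpha_1:\mathcal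 H_1[\mathcal M^0]\to\mathcal M$, $\alpha_2:\mathcal M\to\mathcal G_1[\mathcal M^0]$, $\beta_1:\mathcal H_2[\mathcal M^0]\to\mathcal M$, $\beta_2:\mathcal M\to\mathcal G_2[\mathcal M^0]$ (pullbacks along $\tau$ for index 1, along $\sigma$ for index 2) such that: $\alpha_2\alpha_1=\tau^*\partial_1$ and $\beta_2\beta_1=\sigma^*\partial_2$; $\beta_2\alpha_1$ and $\alpha_2\beta_1$ take values in units; $\mathcal H_2[\mathcal M^0]\xrightarrow{\beta_1}\mathcal M\xrightarrow{\alpha_2}\mathcal G_1[\mathcal M^0]$ is an extension of topological groupoids ($\beta_1$ a homeomorphism onto its image, $\alpha_2$ surjective, image of $\beta_1$ equal to the kernel of $\alpha_2$); and $\alpha_1(h_1^{\alpha_2(m)})=m^{-1}\alpha_1(h_1)m$, $\beta_1(h_2^{\beta_2(m)})=m^{-1}\beta_1(h_2)m$ for all $m\in\mathcal M$ and $h_1,h_2$ in the fibres over $t(m)$. **2-groupoids.** A topological $2$-groupoid $\mathbf G$ is a strict $2$-category with all $1$- and $2$-arrows invertible, with topological spaces $\mathbf G^0,\mathbf G^1,\mathbf G^2$ of objects, $1$-arrows, $2$-arrows and all structure maps continuous ($s,t:\mathbf G^1\to\mathbf G^0$; $s_2,t_2:\mathbf G^2\to\mathbf G^1$). A strict homomorphism is a continuous strict $2$-functor. A strict homomorphism $\phi:\mathbf G\to\mathbf H$ is a weak equivalence if: (WE1) $\mathbf G^0\times_{\phi,\mathbf H^0,t}\mathbf H^1\to\mathbf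 H^0$, $(x,\gamma)\mapsto s(\gamma)$, is surjective; (WE2) $\mathbf G^1\times_{\phi,\mathbf H^1,t_2}\mathbf H^2\to\mathbf H^1[\mathbf G^0]$, $(g,b)\mapsto(t(g),s_2(b),s(g))$, is surjective; (WE3) the square with $\phi:\mathbf G^2\to\mathbf H^2$, $(s_2,t_2)$ and $\phi\times\phi:\mathbf G^1\times\mathbf G^1\to\mathbf H^1\times\mathbf H^1$ is a pullback of topological spaces. A weak homomorphism from $\mathbf G$ to $\mathbf H$ is a zig-zag $\mathbf G\leftarrow\mathbf G'\to\mathbf H$ of strict homomorphisms whose leftward arrow is a weak equivalence. **Associated 2-groupoid and hypercovers.** The topological $2$-groupoid associated to $\mathfrak G=(\mathcal H\xrightarrow{\partial}\mathcal G)$ is $\mathcal H\rtimes\mathcal G\rightrightarrows\mathcal G\rightrightarrows\mathcal G^0$, with $\mathcal H\rtimes\mathcal G=\{(h,g):h\in\mathcal H^{t(g)}\}$, $s_2(h,g)=g$, $t_2(h,g)=\partial(h)g$, horizontal composition $(h_1,g_1)\star_h(h_2,g_2)=(h_1h_2^{g_1^{-1}},g_1g_2)$, and the vertical composite of $(h,g)$ followed by $(k,\partial(h)g)$ equal to $(kh,g)$. A strict morphism of crossed modules is a hypercover if the induced strict homomorphism of associated $2$-groupoids is a weak equivalence.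
   Formalization: Assumes the unit space of G_2 is nonempty if that of G_1 is (fails for empty M otherwise); that the zig-zag factors through M is claimed only when τ satisfies (WE1), which is necessary; otherwise only a zig-zag with leftward hypercover is asserted. *)

theory Defs
  imports "HOL-Analysis.Analysis"
begin

section \<open>Topological groupoids\<close>

text \<open>
  Objects and arrows are carried by the underlying sets of two abstract topologies; values of
  the operations outside the carriers are irrelevant.  Objects are kept as a separate type,
  and \<open>idn\<close> embeds them as identity arrows.  The composite \<open>cmp g f\<close> is meaningful when
  \<open>src g = tgt f\<close>.
\<close>

record ('x, 'a) tgpd =
  Obj :: "'x topology"
  Arr :: "'a topology"
  src :: "'a \<Rightarrow> 'x"
  tgt :: "'a \<Rightarrow> 'x"
  idn :: "'x \<Rightarrow> 'a"
  ginv :: "'a \<Rightarrow> 'a"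
  cmp :: "'a \<Rightarrow> 'a \<Rightarrow> 'a"

definition topological_groupoid :: "('x, 'a) tgpd \<Rightarrow> bool" where
  "topological_groupoid G \<longleftrightarrow>
     continuous_map (Arr G) (Obj G) (src G) \<and>
     continuous_map (Arr G) (Obj G) (tgt G) \<and>
     continuous_map (Obj G) (Arr G) (idn G) \<and>
     continuous_map (Arr G) (Arr G) (ginv G) \<and>
     continuous_map (subtopology (prod_topology (Arr G) (Arr G)) {(g, f). src G g = tgt G f})
       (Arr G) (\<lambda>(g, f). cmp G g f) \<and>
     (\<forall>x\<in>topspace (Obj G). src G (idn G x) = x \<and> tgt G (idn G x) = x) \<and>
     (\<forall>g\<in>topspace (Arr G). \<forall>f\<in>topspace (Arr G). src G g = tgt G f \<longrightarrow>
        src G (cmp G g f) = src G f \<and> tgt G (cmp G g f) = tgt G g) \<and>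
     (\<forall>g\<in>topspace (Arr G). \<forall>f\<in>topspace (Arr G). \<forall>e\<in>topspace (Arr G).
        src G g = tgt G f \<longrightarrow> src G f = tgt G e \<longrightarrow>
        cmp G (cmp G g f) e = cmp G g (cmp G f e)) \<and>
     (\<forall>g\<in>topspace (Arr G). cmp G (idn G (tgt G g)) g = g \<and> cmp G g (idn G (src G g)) = g) \<and>
     (\<forall>g\<in>topspace (Arr G). src G (ginv G g) = tgt G g \<and> tgt G (ginv G g) = src G g \<and>
        cmp G g (ginv G g) = idn G (tgt G g) \<and> cmp G (ginv G g) g = idn G (src G g))"

definition groupoid_morphism ::
  "('x, 'a) tgpd \<Rightarrow> ('y, 'b) tgpd \<Rightarrow> ('x \<Rightarrow> 'y) \<Rightarrow> ('a \<Rightarrow> 'b) \<Rightarrow> bool" where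
  "groupoid_morphism G K f0 f1 \<longleftrightarrow>
     continuous_map (Obj G) (Obj K) f0 \<and>
     continuous_map (Arr G) (Arr K) f1 \<and>
     (\<forall>g\<in>topspace (Arr G). src K (f1 g) = f0 (src G g) \<and> tgt K (f1 g) = f0 (tgt G g)) \<and>
     (\<forall>x\<in>topspace (Obj G). f1 (idn G x) = idn K (f0 x)) \<and>
     (\<forall>g\<in>topspace (Arr G). \<forall>f\<in>topspace (Arr G). src G g = tgt G f \<longrightarrow>
        f1 (cmp G g f) = cmp K (f1 g) (f1 f))"

definition unit_arrows :: "('x, 'a) tgpd \<Rightarrow> 'a set" where
  "unit_arrows G = idn G ` topspace (Obj G)"

definition group_bundle :: "('x, 'h) tgpd \<Rightarrow> bool" where
  "group_bundle H \<longleftrightarrow> topological_groupoid H \<and> (\<forall>h\<in>topspace (Arr H). src H h = tgt H h)"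

definition fibre :: "('x, 'h) tgpd \<Rightarrow> 'x \<Rightarrow> 'h set" where
  "fibre H x = {h \<in> topspace (Arr H). tgt H h = x}"

section \<open>Groupoid crossed modules\<close>

text \<open>\<open>act h g\<close> is the element written \<open>h\<^sup>g\<close>, for \<open>h\<close> in the fibre over \<open>tgt g\<close>.\<close>

definition action_by_automorphisms ::
  "('x, 'g) tgpd \<Rightarrow> ('x, 'h) tgpd \<Rightarrow> ('h \<Rightarrow> 'g \<Rightarrow> 'h) \<Rightarrow> bool" where
  "action_by_automorphisms G H act \<longleftrightarrow>
     continuous_map
       (subtopology (prod_topology (Arr H) (Arr G)) {(h, g). tgt H h = tgt G g})
       (Arr H) (\<lambda>(h, g). act h g) \<and>
     (\<forall>g\<in>topspace (Arr G).
        homeomorphic_map (subtopology (Arr H) (fibre H (tgt G g)))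
          (subtopology (Arr H) (fibre H (src G g))) (\<lambda>h. act h g) \<and>
        (\<forall>h\<in>fibre H (tgt G g). \<forall>k\<in>fibre H (tgt G g).
           act (cmp H h k) g = cmp H (act h g) (act k g))) \<and>
     (\<forall>g\<in>topspace (Arr G). \<forall>f\<in>topspace (Arr G). src G g = tgt G f \<longrightarrow>
        (\<forall>h\<in>fibre H (tgt G g). act h (cmp G g f) = act (act h g) f)) \<and>
     (\<forall>x\<in>topspace (Obj G). \<forall>h\<in>fibre H x. act h (idn G x) = h)"

record ('x, 'g, 'h) xmod =
  xgrp :: "('x, 'g) tgpd"
  xbun :: "('x, 'h) tgpd"
  bd :: "'h \<Rightarrow> 'g"
  act :: "'h \<Rightarrow> 'g \<Rightarrow> 'h"

definition groupoid_crossed_module :: "('x, 'g, 'h) xmod \<Rightarrow> bool" where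
  "groupoid_crossed_module C \<longleftrightarrow>
     (let G = xgrp C; H = xbun C in
       topological_groupoid G \<and> group_bundle H \<and> Obj H = Obj G \<and>
       groupoid_morphism H G (\<lambda>x. x) (bd C) \<and>
       action_by_automorphisms G H (act C) \<and>
       (\<forall>g\<in>topspace (Arr G). \<forall>h\<in>fibre H (tgt G g).
          bd C (act C h g) = cmp G (cmp G (ginv G g) (bd C h)) g) \<and>
       (\<forall>x\<in>topspace (Obj G). \<forall>h\<in>fibre H x. \<forall>k\<in>fibre H x.
          act C k (bd C h) = cmp H (cmp H (ginv H h) k) h))"

record ('x1, 'g1, 'h1, 'x2, 'g2, 'h2) xmor =
  on_obj :: "'x1 \<Rightarrow> 'x2"
  on_grp :: "'g1 \<Rightarrow> 'g2"
  on_bun :: "'h1 \<Rightarrow> 'h2"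

definition xmod_morphism ::
  "('x1, 'g1, 'h1) xmod \<Rightarrow> ('x2, 'g2, 'h2) xmod
     \<Rightarrow> ('x1, 'g1, 'h1, 'x2, 'g2, 'h2) xmor \<Rightarrow> bool" where
  "xmod_morphism C D \<omega> \<longleftrightarrow>
     groupoid_morphism (xbun C) (xbun D) (on_obj \<omega>) (on_bun \<omega>) \<and>
     groupoid_morphism (xgrp C) (xgrp D) (on_obj \<omega>) (on_grp \<omega>) \<and>
     (\<forall>h\<in>topspace (Arr (xbun C)). on_grp \<omega> (bd C h) = bd D (on_bun \<omega> h)) \<and>
     (\<forall>g\<in>topspace (Arr (xgrp C)). \<forall>h\<in>fibre (xbun C) (tgt (xgrp C) g).
        on_bun \<omega> (act C h g) = act D (on_bun \<omega> h) (on_grp \<omega> g))"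

section \<open>Pullbacks along a map \<open>\<sigma> : Z \<rightarrow> G\<^sup>0\<close>\<close>

definition pb_groupoid ::
  "('x, 'g) tgpd \<Rightarrow> 'z topology \<Rightarrow> ('z \<Rightarrow> 'x) \<Rightarrow> ('z, 'z \<times> 'g \<times> 'z) tgpd" where
  "pb_groupoid G Z \<sigma> =
     \<lparr>Obj = Z,
      Arr = subtopology (prod_topology Z (prod_topology (Arr G) Z))
              {(z1, g, z2). \<sigma> z1 = tgt G g \<and> src G g = \<sigma> z2},
      src = (\<lambda>(z1, g, z2). z2),
      tgt = (\<lambda>(z1, g, z2). z1),
      idn = (\<lambda>z. (z, idn G (\<sigma> z), z)),
      ginv = (\<lambda>(z1, g, z2). (z2, ginv G g, z1)),
      cmp = (\<lambda>(z1, g, z2) (w2, f, w3). (z1, cmp G g f, w3))\<rparr>"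

definition pb_bundle ::
  "('x, 'h) tgpd \<Rightarrow> 'z topology \<Rightarrow> ('z \<Rightarrow> 'x) \<Rightarrow> ('z, 'z \<times> 'h) tgpd" where
  "pb_bundle H Z \<sigma> =
     \<lparr>Obj = Z,
      Arr = subtopology (prod_topology Z (Arr H)) {(z, h). h \<in> fibre H (\<sigma> z)},
      src = fst,
      tgt = fst,
      idn = (\<lambda>z. (z, idn H (\<sigma> z))),
      ginv = (\<lambda>(z, h). (z, ginv H h)),
      cmp = (\<lambda>(z, h) (w, k). (z, cmp H h k))\<rparr>"

definition pb_xmod ::
  "('x, 'g, 'h) xmod \<Rightarrow> 'z topology \<Rightarrow> ('z \<Rightarrow> 'x) \<Rightarrow> ('z, 'z \<times> 'g \<times> 'z, 'z \<times> 'h) xmod" where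
  "pb_xmod C Z \<sigma> =
     \<lparr>xgrp = pb_groupoid (xgrp C) Z \<sigma>,
      xbun = pb_bundle (xbun C) Z \<sigma>,
      bd = (\<lambda>(z, h). (z, bd C h, z)),
      act = (\<lambda>(z, h) (z1, g, z2). (z2, act C h g))\<rparr>"

section \<open>Crossings\<close>

text \<open>An extension of topological groupoids over one unit space, with identity on units.\<close>

definition groupoid_extension ::
  "('m0, 'n) tgpd \<Rightarrow> ('m0, 'm) tgpd \<Rightarrow> ('m0, 'q) tgpd \<Rightarrow> ('n \<Rightarrow> 'm) \<Rightarrow> ('m \<Rightarrow> 'q) \<Rightarrow> bool" where
  "groupoid_extension N M Q i p \<longleftrightarrow>
     embedding_map (Arr N) (Arr M) i \<and>
     p ` topspace (Arr M) = topspace (Arr Q) \<and>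
     i ` topspace (Arr N) = {m \<in> topspace (Arr M). p m \<in> unit_arrows Q}"

record ('m0, 'm, 'x1, 'g1, 'h1, 'x2, 'g2, 'h2) crossing_data =
  mid :: "('m0, 'm) tgpd"
  tau :: "'m0 \<Rightarrow> 'x1"
  sigma :: "'m0 \<Rightarrow> 'x2"
  alpha1 :: "'m0 \<times> 'h1 \<Rightarrow> 'm"
  alpha2 :: "'m \<Rightarrow> 'm0 \<times> 'g1 \<times> 'm0"
  beta1 :: "'m0 \<times> 'h2 \<Rightarrow> 'm"
  beta2 :: "'m \<Rightarrow> 'm0 \<times> 'g2 \<times> 'm0"

definition crossing ::
  "('x1, 'g1, 'h1) xmod \<Rightarrow> ('x2, 'g2, 'h2) xmod
     \<Rightarrow> ('m0, 'm, 'x1, 'g1, 'h1, 'x2, 'g2, 'h2) crossing_data \<Rightarrow> bool" where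
  "crossing C1 C2 K \<longleftrightarrow>
     (let M = mid K;
          P1 = pb_xmod C1 (Obj M) (tau K);
          P2 = pb_xmod C2 (Obj M) (sigma K)
      in
       topological_groupoid M \<and>
       continuous_map (Obj M) (Obj (xgrp C1)) (tau K) \<and>
       continuous_map (Obj M) (Obj (xgrp C2)) (sigma K) \<and>
       groupoid_morphism (xbun P1) M (\<lambda>z. z) (alpha1 K) \<and>
       groupoid_morphism M (xgrp P1) (\<lambda>z. z) (alpha2 K) \<and>
       groupoid_morphism (xbun P2) M (\<lambda>z. z) (beta1 K) \<and>
       groupoid_morphism M (xgrp P2) (\<lambda>z. z) (beta2 K) \<and>
       (\<forall>h\<in>topspace (Arr (xbun P1)). alpha2 K (alpha1 K h) = bd P1 h) \<and>
       (\<forall>h\<in>topspace (Arr (xbun P2)). beta2 K (beta1 K h) = bd P2 h) \<and>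
       (\<forall>h\<in>topspace (Arr (xbun P1)). beta2 K (alpha1 K h) \<in> unit_arrows (xgrp P2)) \<and>
       (\<forall>h\<in>topspace (Arr (xbun P2)). alpha2 K (beta1 K h) \<in> unit_arrows (xgrp P1)) \<and>
       groupoid_extension (xbun P2) M (xgrp P1) (beta1 K) (alpha2 K) \<and>
       (\<forall>m\<in>topspace (Arr M). \<forall>h\<in>fibre (xbun P1) (tgt M m).
          alpha1 K (act P1 h (alpha2 K m)) = cmp M (cmp M (ginv M m) (alpha1 K h)) m) \<and>
       (\<forall>m\<in>topspace (Arr M). \<forall>h\<in>fibre (xbun P2) (tgt M m).
          beta1 K (act P2 h (beta2 K m)) = cmp M (cmp M (ginv M m) (beta1 K h)) m))"

section \<open>Topological 2-groupoids\<close>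

text \<open>
  A strict 2-groupoid is given by three groupoids sharing their carriers: 1-arrows over
  objects (\<open>one\<close>), 2-arrows over 1-arrows under vertical composition (\<open>vert\<close>, whose \<open>src\<close>
  and \<open>tgt\<close> are the maps \<open>s\<^sub>2\<close> and \<open>t\<^sub>2\<close>), and 2-arrows over objects under horizontal
  composition (\<open>horiz\<close>).  Horizontal inverses of 2-arrows exist automatically once 1-arrows
  and vertical 2-arrows are invertible, and are continuous, being expressible through the
  other operations.
\<close>

record ('x, 'a, 'b) tgpd2 =
  one :: "('x, 'a) tgpd"
  vert :: "('a, 'b) tgpd"
  horiz :: "('x, 'b) tgpd"

definition topological_2groupoid :: "('x, 'a, 'b) tgpd2 \<Rightarrow> bool" where
  "topological_2groupoid G \<longleftrightarrow>
     (let O1 = one G; V = vert G; W = horiz G in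
       topological_groupoid O1 \<and> topological_groupoid V \<and> topological_groupoid W \<and>
       Obj V = Arr O1 \<and> Obj W = Obj O1 \<and> Arr W = Arr V \<and>
       (\<forall>b\<in>topspace (Arr V).
          src W b = src O1 (src V b) \<and> src W b = src O1 (tgt V b) \<and>
          tgt W b = tgt O1 (src V b) \<and> tgt W b = tgt O1 (tgt V b)) \<and>
       (\<forall>b\<in>topspace (Arr V). \<forall>a\<in>topspace (Arr V). src W b = tgt W a \<longrightarrow>
          src V (cmp W b a) = cmp O1 (src V b) (src V a) \<and>
          tgt V (cmp W b a) = cmp O1 (tgt V b) (tgt V a)) \<and>
       (\<forall>x\<in>topspace (Obj O1). idn W x = idn V (idn O1 x)) \<and>
       (\<forall>g\<in>topspace (Arr O1). \<forall>f\<in>topspace (Arr O1). src O1 g = tgt O1 f \<longrightarrow>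
          idn V (cmp O1 g f) = cmp W (idn V g) (idn V f)) \<and>
       (\<forall>b\<in>topspace (Arr V). \<forall>b'\<in>topspace (Arr V).
        \<forall>a\<in>topspace (Arr V). \<forall>a'\<in>topspace (Arr V).
          src V b' = tgt V b \<longrightarrow> src V a' = tgt V a \<longrightarrow> src W b = tgt W a \<longrightarrow>
          cmp W (cmp V b' b) (cmp V a' a) = cmp V (cmp W b' a') (cmp W b a)))"

record ('x1, 'a1, 'b1, 'x2, 'a2, 'b2) hom2 =
  hom0 :: "'x1 \<Rightarrow> 'x2"
  hom1 :: "'a1 \<Rightarrow> 'a2"
  homb :: "'b1 \<Rightarrow> 'b2"

definition strict_homomorphism ::
  "('x1, 'a1, 'b1) tgpd2 \<Rightarrow> ('x2, 'a2, 'b2) tgpd2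
     \<Rightarrow> ('x1, 'a1, 'b1, 'x2, 'a2, 'b2) hom2 \<Rightarrow> bool" where
  "strict_homomorphism G H \<phi> \<longleftrightarrow>
     groupoid_morphism (one G) (one H) (hom0 \<phi>) (hom1 \<phi>) \<and>
     groupoid_morphism (vert G) (vert H) (hom1 \<phi>) (homb \<phi>) \<and>
     groupoid_morphism (horiz G) (horiz H) (hom0 \<phi>) (homb \<phi>)"

text \<open>Surjectivity of \<open>(x, \<gamma>) \<mapsto> s(\<gamma>)\<close> on the fibre product of \<open>f : Z \<rightarrow> G\<^sup>0\<close> and \<open>t\<close>.\<close>

definition essentially_surjective :: "'z topology \<Rightarrow> ('z \<Rightarrow> 'x) \<Rightarrow> ('x, 'g) tgpd \<Rightarrow> bool" where
  "essentially_surjective Z f G \<longleftrightarrow>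
     (\<lambda>(x, \<gamma>). src G \<gamma>) ` {(x, \<gamma>). x \<in> topspace Z \<and> \<gamma> \<in> topspace (Arr G) \<and> f x = tgt G \<gamma>}
       = topspace (Obj G)"

text \<open>
  In the third condition the square is a pullback over the full product of two copies of the
  space of 1-arrows, not only over pairs of parallel 1-arrows.  Being a pullback of topological
  spaces means that the canonical map to the fibre product is a homeomorphism.
\<close>

definition weak_equivalence ::
  "('x1, 'a1, 'b1) tgpd2 \<Rightarrow> ('x2, 'a2, 'b2) tgpd2
     \<Rightarrow> ('x1, 'a1, 'b1, 'x2, 'a2, 'b2) hom2 \<Rightarrow> bool" where
  "weak_equivalence G H \<phi> \<longleftrightarrow>
     strict_homomorphism G H \<phi> \<and>
     essentially_surjective (Obj (one G)) (hom0 \<phi>) (one H) \<and>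
     (\<lambda>(g, b). (tgt (one G) g, src (vert H) b, src (one G) g)) `
         {(g, b). g \<in> topspace (Arr (one G)) \<and> b \<in> topspace (Arr (vert H)) \<and>
                  hom1 \<phi> g = tgt (vert H) b}
       = topspace (Arr (pb_groupoid (one H) (Obj (one G)) (hom0 \<phi>))) \<and>
     homeomorphic_map (Arr (vert G))
       (subtopology
          (prod_topology (Arr (vert H)) (prod_topology (Arr (one G)) (Arr (one G))))
          {(b, g, g'). src (vert H) b = hom1 \<phi> g \<and> tgt (vert H) b = hom1 \<phi> g'})
       (\<lambda>a. (homb \<phi> a, src (vert G) a, tgt (vert G) a))"

definition weak_homomorphism ::
  "('x1, 'a1, 'b1) tgpd2 \<Rightarrow> ('x2, 'a2, 'b2) tgpd2 \<Rightarrow> ('x, 'a, 'b) tgpd2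
     \<Rightarrow> ('x, 'a, 'b, 'x1, 'a1, 'b1) hom2 \<Rightarrow> ('x, 'a, 'b, 'x2, 'a2, 'b2) hom2 \<Rightarrow> bool" where
  "weak_homomorphism G H G' \<phi> \<psi> \<longleftrightarrow>
     topological_2groupoid G \<and> topological_2groupoid H \<and> topological_2groupoid G' \<and>
     weak_equivalence G' G \<phi> \<and> strict_homomorphism G' H \<psi>"

section \<open>The associated 2-groupoid and hypercovers\<close>

text \<open>
  In \<open>cmp\<close> of the vertical groupoid the second argument comes first in time: the composite of
  \<open>(h, g)\<close> followed by \<open>(k, g')\<close> with \<open>g' = \<partial>(h)g\<close> is \<open>(kh, g)\<close>.
\<close>

definition assoc_2groupoid :: "('x, 'g, 'h) xmod \<Rightarrow> ('x, 'g, 'h \<times> 'g) tgpd2" where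
  "assoc_2groupoid C =
     (let G = xgrp C; H = xbun C;
          T = subtopology (prod_topology (Arr H) (Arr G)) {(h, g). h \<in> fibre H (tgt G g)}
      in
       \<lparr>one = G,
        vert =
          \<lparr>Obj = Arr G, Arr = T,
           src = (\<lambda>(h, g). g),
           tgt = (\<lambda>(h, g). cmp G (bd C h) g),
           idn = (\<lambda>g. (idn H (tgt G g), g)),
           ginv = (\<lambda>(h, g). (ginv H h, cmp G (bd C h) g)),
           cmp = (\<lambda>(k, g') (h, g). (cmp H k h, g))\<rparr>,
        horiz =
          \<lparr>Obj = Obj G, Arr = T,
           src = (\<lambda>(h, g). src G g),
           tgt = (\<lambda>(h, g). tgt G g),
           idn = (\<lambda>x. (idn H x, idn G x)),
           ginv = (\<lambda>(h, g). (act C (ginv H h) g, ginv G g)),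
           cmp = (\<lambda>(h1, g1) (h2, g2). (cmp H h1 (act C h2 (ginv G g1)), cmp G g1 g2))\<rparr>\<rparr>)"

definition assoc_hom ::
  "('x1, 'g1, 'h1, 'x2, 'g2, 'h2) xmor \<Rightarrow> ('x1, 'g1, 'h1 \<times> 'g1, 'x2, 'g2, 'h2 \<times> 'g2) hom2" where
  "assoc_hom \<omega> =
     \<lparr>hom0 = on_obj \<omega>, hom1 = on_grp \<omega>, homb = (\<lambda>(h, g). (on_bun \<omega> h, on_grp \<omega> g))\<rparr>"

definition hypercover ::
  "('x1, 'g1, 'h1) xmod \<Rightarrow> ('x2, 'g2, 'h2) xmod
     \<Rightarrow> ('x1, 'g1, 'h1, 'x2, 'g2, 'h2) xmor \<Rightarrow> bool" where
  "hypercover C D \<omega> \<longleftrightarrow>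
     xmod_morphism C D \<omega> \<and>
     weak_equivalence (assoc_2groupoid C) (assoc_2groupoid D) (assoc_hom \<omega>)"

text \<open>
  A zig-zag \<open>C1 \<leftarrow> C' \<rightarrow> C2\<close> is induced by a crossing if both legs factor through the crossing:
  some strict morphism from the groupoid of \<open>C'\<close> to the middle groupoid, followed by
  \<open>\<alpha>\<^sub>2\<close> and \<open>\<beta>\<^sub>2\<close>, gives the legs on arrows, and on the bundle the structure map of \<open>C'\<close>
  corresponds to \<open>\<alpha>\<^sub>1 \<cdot> \<beta>\<^sub>1\<close>.
\<close>

definition induced_by_crossing ::
  "('m0, 'm, 'x1, 'g1, 'h1, 'x2, 'g2, 'h2) crossing_data \<Rightarrow> ('x, 'g, 'h) xmod
     \<Rightarrow> ('x, 'g, 'h, 'x1, 'g1, 'h1) xmor \<Rightarrow> ('x, 'g, 'h, 'x2, 'g2, 'h2) xmor \<Rightarrow> bool" where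
  "induced_by_crossing K C' \<phi> \<psi> \<longleftrightarrow>
     (\<exists>\<theta>0 \<theta>. let G = xgrp C'; H = xbun C' in
        groupoid_morphism G (mid K) \<theta>0 \<theta> \<and>
        (\<forall>x\<in>topspace (Obj G).
           on_obj \<phi> x = tau K (\<theta>0 x) \<and> on_obj \<psi> x = sigma K (\<theta>0 x)) \<and>
        (\<forall>g\<in>topspace (Arr G).
           alpha2 K (\<theta> g) = (\<theta>0 (tgt G g), on_grp \<phi> g, \<theta>0 (src G g)) \<and>
           beta2 K (\<theta> g) = (\<theta>0 (tgt G g), on_grp \<psi> g, \<theta>0 (src G g))) \<and>
        (\<forall>h\<in>topspace (Arr H).
           \<theta> (bd C' h) = cmp (mid K) (alpha1 K (\<theta>0 (tgt H h), on_bun \<phi> h))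
                                     (beta1 K (\<theta>0 (tgt H h), on_bun \<psi> h))))"

end

theory Submission
  imports Defs
begin

text \<open>
  The classical construction attaches to a crossing \<open>M\<close> the crossed module whose group bundle is the
  fibre product of the two pulled back bundles over the objects of \<open>M\<close> and whose boundary map is
  \<open>(h, k) \<mapsto> \<alpha>\<^sub>1(h) \<beta>\<^sub>1(k)\<close>.  This is multiplicative because the images of \<open>\<alpha>\<^sub>1\<close> and \<open>\<beta>\<^sub>1\<close> commute
  (\<open>alpha1_beta1_commute\<close>): \<open>\<beta>\<^sub>2\<close> sends \<open>\<alpha>\<^sub>1(h)\<close> to a unit, so conjugation by \<open>\<alpha>\<^sub>1(h)\<close> acts trivially on
  the image of \<open>\<beta>\<^sub>1\<close>.  The legs are \<open>\<alpha>\<^sub>2\<close> and \<open>\<beta>\<^sub>2\<close> on arrows, and the two coordinates on the bundle.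

  The left leg has to satisfy the pullback condition on 2-arrows over the full product
  \<open>M \<times> M\<close>.  As source and target of a 2-arrow are parallel, this forces injectivity on objects: if
  \<open>x\<close> and \<open>y\<close> have the same image, the identity 2-arrow over it together with the units at \<open>x\<close> and \<open>y\<close>
  is a point of the fibre product, and it comes from a 2-arrow only if \<open>x = y\<close>.  The construction is
  therefore applied after restricting \<open>M\<close> to a set \<open>S\<close> of objects on which \<open>\<tau>\<close> is injective and has
  the same image as before.  No continuity of the choice is involved: \<open>S\<close> and the arrows between its points carry
  the subspace topologies, and essential surjectivity depends only on the image of \<open>\<tau>\<close>.

  On the restricted crossing the left leg exhibits the new bundle as the fibre product of the
  boundary map of \<open>C1\<close> with \<open>\<alpha>\<^sub>2\<close> (\<open>N_cartesian_cover\<close>): given \<open>h\<close> and \<open>m\<close> with \<open>\<partial>\<^sub>1(h) = \<alpha>\<^sub>2(m)\<close>, the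
  arrow \<open>\<alpha>\<^sub>1(h)\<^sup>-\<^sup>1 m\<close> lies in the kernel of \<open>\<alpha>\<^sub>2\<close>, hence is \<open>\<beta>\<^sub>1(k)\<close> for a unique \<open>k\<close>, which depends
  continuously on it because \<open>\<beta>\<^sub>1\<close> is an embedding.  A full, essentially surjective morphism that is
  injective on objects and cartesian in this sense is a hypercover (\<open>cartesian_cover_hypercover\<close>).

  If \<open>\<tau>\<close> is not essentially surjective, the crossing does not reach all of \<open>C1\<close>, and the zig-zag
  consists of the identity of \<open>C1\<close> and a constant morphism to \<open>C2\<close>.  In both cases the
  middle crossed module is finally moved along an injection into the required sum types.
\<close>

section \<open>Continuity rules\<close>

lemma cont_fst: "continuous_map X (prod_topology Y Z) f \<Longrightarrow> continuous_map X Y (\<lambda>x. fst (f x))"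
  using continuous_map_fst_of by (fastforce simp: o_def)

lemma cont_snd: "continuous_map X (prod_topology Y Z) f \<Longrightarrow> continuous_map X Z (\<lambda>x. snd (f x))"
  using continuous_map_snd_of by (fastforce simp: o_def)

lemma cont_out: "continuous_map X (subtopology Y S) f \<Longrightarrow> continuous_map X Y f"
  by (simp add: continuous_map_in_subtopology)

lemma cont_incl: "continuous_map (subtopology X S) X (\<lambda>x. x)"
  using continuous_map_from_subtopology[OF continuous_map_id] by (simp add: id_def)

lemma cont_into:
  "continuous_map X Y f \<Longrightarrow> (\<And>x. x \<in> topspace X \<Longrightarrow> f x \<in> S) \<Longrightarrow> continuous_map X (subtopology Y S) f"
  by (auto intro: continuous_map_into_subtopology)

lemma cont_comp: "continuous_map X Y f \<Longrightarrow> continuous_map Y Z g \<Longrightarrow> continuous_map X Z (\<lambda>x. g (f x))"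
  using continuous_map_compose by (fastforce simp: o_def)

lemma cont_in: "continuous_map X Y f \<Longrightarrow> x \<in> topspace X \<Longrightarrow> f x \<in> topspace Y"
  by (auto simp: continuous_map_def)

lemmas cont_id = continuous_map_id[unfolded id_def]

lemma cont_const: "(\<And>y. y \<in> topspace X \<Longrightarrow> c \<in> topspace Y) \<Longrightarrow> continuous_map X Y (\<lambda>_. c)"
  unfolding continuous_map_const by (metis equals0I null_topspace_iff_trivial)

text \<open>
  Coordinates of a point of a subspace of a product: one digit for a pair, two digits for a pair
  of points that lie themselves in subspaces of products.
\<close>

lemmas cont_pr1 = cont_incl[THEN cont_fst]
lemmas cont_pr2 = cont_incl[THEN cont_snd]
lemmas cont_pr11 = cont_incl[THEN cont_fst, THEN cont_out, THEN cont_fst]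
lemmas cont_pr12 = cont_incl[THEN cont_fst, THEN cont_out, THEN cont_snd]
lemmas cont_pr21 = cont_incl[THEN cont_snd, THEN cont_out, THEN cont_fst]
lemmas cont_pr22 = cont_incl[THEN cont_snd, THEN cont_out, THEN cont_snd]

section \<open>Topological groupoids\<close>

abbreviation arrows :: "('x, 'a) tgpd \<Rightarrow> 'a set" where
  "arrows G \<equiv> topspace (Arr G)"

abbreviation objects :: "('x, 'a) tgpd \<Rightarrow> 'x set" where
  "objects G \<equiv> topspace (Obj G)"

locale top_gpd =
  fixes G :: "('x, 'a) tgpd"
  assumes top_gpd: "topological_groupoid G"
begin

lemma cont_src: "continuous_map (Arr G) (Obj G) (src G)"
  and cont_tgt: "continuous_map (Arr G) (Obj G) (tgt G)"
  and cont_idn: "continuous_map (Obj G) (Arr G) (idn G)"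
  and cont_ginv: "continuous_map (Arr G) (Arr G) (ginv G)"
  using top_gpd by (auto simp: topological_groupoid_def)

lemma cont_cmp:
  assumes "continuous_map X (Arr G) f" "continuous_map X (Arr G) g"
    and "\<And>x. x \<in> topspace X \<Longrightarrow> src G (f x) = tgt G (g x)"
  shows "continuous_map X (Arr G) (\<lambda>x. cmp G (f x) (g x))"
proof -
  have "continuous_map X (subtopology (prod_topology (Arr G) (Arr G)) {(g, f). src G g = tgt G f})
          (\<lambda>x. (f x, g x))"
    using assms by (intro cont_into continuous_map_pairedI) auto
  moreover have "continuous_map
      (subtopology (prod_topology (Arr G) (Arr G)) {(g, f). src G g = tgt G f})
       (Arr G) (\<lambda>(g, f). cmp G g f)"
    using top_gpd by (simp add: topological_groupoid_def)
  ultimately show ?thesis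
    by (auto dest: cont_comp)
qed

lemma src_in [simp, intro]: "g \<in> arrows G \<Longrightarrow> src G g \<in> objects G"
  and tgt_in [simp, intro]: "g \<in> arrows G \<Longrightarrow> tgt G g \<in> objects G"
  and idn_in [simp, intro]: "x \<in> objects G \<Longrightarrow> idn G x \<in> arrows G"
  and ginv_in [simp, intro]: "g \<in> arrows G \<Longrightarrow> ginv G g \<in> arrows G"
  using cont_src cont_tgt cont_idn cont_ginv by (auto dest: cont_in)

lemma cmp_in [simp, intro]:
  assumes "g \<in> arrows G" "f \<in> arrows G" "src G g = tgt G f"
  shows "cmp G g f \<in> arrows G"
proof -
  have "continuous_map (subtopology (prod_topology (Arr G) (Arr G)) {(g, f). src G g = tgt G f})
       (Arr G) (\<lambda>(g, f). cmp G g f)"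
    using top_gpd by (simp add: topological_groupoid_def)
  from cont_in[OF this, of "(g, f)"] show ?thesis
    using assms by simp
qed

lemma src_idn [simp]: "x \<in> objects G \<Longrightarrow> src G (idn G x) = x"
  and tgt_idn [simp]: "x \<in> objects G \<Longrightarrow> tgt G (idn G x) = x"
  and src_cmp [simp]: "\<lbrakk>g \<in> arrows G; f \<in> arrows G; src G g = tgt G f\<rbrakk> \<Longrightarrow> src G (cmp G g f) = src G f"
  and tgt_cmp [simp]: "\<lbrakk>g \<in> arrows G; f \<in> arrows G; src G g = tgt G f\<rbrakk> \<Longrightarrow> tgt G (cmp G g f) = tgt G g"
  and src_ginv [simp]: "g \<in> arrows G \<Longrightarrow> src G (ginv G g) = tgt G g"
  and tgt_ginv [simp]: "g \<in> arrows G \<Longrightarrow> tgt G (ginv G g) = src G g"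
  and cmp_ginv [simp]: "g \<in> arrows G \<Longrightarrow> cmp G g (ginv G g) = idn G (tgt G g)"
  and ginv_cmp [simp]: "g \<in> arrows G \<Longrightarrow> cmp G (ginv G g) g = idn G (src G g)"
  and cmp_idn_left [simp]: "\<lbrakk>g \<in> arrows G; tgt G g = x\<rbrakk> \<Longrightarrow> cmp G (idn G x) g = g"
  and cmp_idn_right [simp]: "\<lbrakk>g \<in> arrows G; src G g = x\<rbrakk> \<Longrightarrow> cmp G g (idn G x) = g"
  and assoc [simp]: "\<lbrakk>g \<in> arrows G; f \<in> arrows G; e \<in> arrows G; src G g = tgt G f; src G f = tgt G e\<rbrakk>
      \<Longrightarrow> cmp G (cmp G g f) e = cmp G g (cmp G f e)"
  using top_gpd by (auto simp: topological_groupoid_def)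

lemma cancel_ginv_left [simp]:
  assumes "g \<in> arrows G" "f \<in> arrows G" "src G g = tgt G f"
  shows "cmp G (ginv G g) (cmp G g f) = f"
  using assms assoc[of "ginv G g" g f] by (simp del: assoc)

lemma cancel_left [simp]:
  assumes "g \<in> arrows G" "f \<in> arrows G" "tgt G g = tgt G f"
  shows "cmp G g (cmp G (ginv G g) f) = f"
  using assms assoc[of g "ginv G g" f] by (simp del: assoc)

lemma ginv_unique:
  assumes "g \<in> arrows G" "f \<in> arrows G" "src G g = tgt G f" "cmp G g f = idn G (tgt G g)"
    "src G f = tgt G g"
  shows "f = ginv G g"
proof -
  have "f = cmp G (ginv G g) (cmp G g f)"
    using assms(1-3) by simp
  also have "\<dots> = ginv G g"
    using assms by (simp del: cancel_ginv_left)
  finally show ?thesis .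
qed

lemma ginv_ginv [simp]: "g \<in> arrows G \<Longrightarrow> ginv G (ginv G g) = g"
  by (rule ginv_unique[symmetric]) auto

lemma ginv_idn [simp]: "x \<in> objects G \<Longrightarrow> ginv G (idn G x) = idn G x"
  by (rule ginv_unique[symmetric]) auto

lemma ginv_of_cmp [simp]:
  assumes "g \<in> arrows G" "f \<in> arrows G" "src G g = tgt G f"
  shows "ginv G (cmp G g f) = cmp G (ginv G f) (ginv G g)"
  using assms by (intro ginv_unique[symmetric]) auto

end

lemma groupoid_morphism_ginv:
  assumes "topological_groupoid G" "topological_groupoid K" "groupoid_morphism G K f0 f1"
    and "g \<in> arrows G"
  shows "f1 (ginv G g) = ginv K (f1 g)"
proof -
  interpret G: top_gpd G by unfold_locales fact
  interpret K: top_gpd K by unfold_locales fact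
  have in_K: "f1 h \<in> arrows K" if "h \<in> arrows G" for h
    using assms(3) that by (auto simp: groupoid_morphism_def dest: cont_in)
  have "cmp K (f1 g) (f1 (ginv G g)) = f1 (cmp G g (ginv G g))"
    using assms(3,4) by (simp add: groupoid_morphism_def del: G.cmp_ginv)
  also have "\<dots> = idn K (tgt K (f1 g))"
    using assms(3,4) by (simp add: groupoid_morphism_def)
  finally show ?thesis
    using assms(3,4) in_K by (intro K.ginv_unique) (auto simp: groupoid_morphism_def)
qed

lemma groupoid_morphism_compose:
  assumes "groupoid_morphism G K f0 f1" "groupoid_morphism K L g0 g1"
  shows "groupoid_morphism G L (\<lambda>x. g0 (f0 x)) (\<lambda>a. g1 (f1 a))"
proof -
  have f: "f1 a \<in> arrows K" if "a \<in> arrows G" for a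
    using assms(1) that by (auto simp: groupoid_morphism_def dest: cont_in)
  have f': "f0 a \<in> objects K" if "a \<in> objects G" for a
    using assms(1) that by (auto simp: groupoid_morphism_def dest: cont_in)
  show ?thesis
    using assms f f' unfolding groupoid_morphism_def by (auto intro: cont_comp)
qed

section \<open>Groupoid crossed modules\<close>

locale crossed_module =
  fixes C :: "('x, 'g, 'h) xmod"
  assumes crossed: "groupoid_crossed_module C"
begin

abbreviation "G \<equiv> xgrp C"
abbreviation "H \<equiv> xbun C"

lemma top_gpd_G: "topological_groupoid G" and top_gpd_H: "topological_groupoid H"
  using crossed by (auto simp: groupoid_crossed_module_def Let_def group_bundle_def)

sublocale G: top_gpd "xgrp C" by unfold_locales (fact top_gpd_G)
sublocale H: top_gpd "xbun C" by unfold_locales (fact top_gpd_H)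

lemma Obj_H [simp]: "Obj H = Obj G"
  using crossed by (auto simp: groupoid_crossed_module_def Let_def)

lemma src_H [simp]: "h \<in> arrows H \<Longrightarrow> src H h = tgt H h"
  using crossed by (auto simp: groupoid_crossed_module_def Let_def group_bundle_def)

lemma morphism_bd: "groupoid_morphism H G (\<lambda>x. x) (bd C)"
  using crossed by (auto simp: groupoid_crossed_module_def Let_def)

lemma cont_bd: "continuous_map (Arr H) (Arr G) (bd C)"
  using morphism_bd by (auto simp: groupoid_morphism_def)

lemma bd_in [simp, intro]: "h \<in> arrows H \<Longrightarrow> bd C h \<in> arrows G"
  using cont_bd by (auto dest: cont_in)

lemma src_bd [simp]: "h \<in> arrows H \<Longrightarrow> src G (bd C h) = tgt H h"
  and tgt_bd [simp]: "h \<in> arrows H \<Longrightarrow> tgt G (bd C h) = tgt H h"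
  and bd_idn [simp]: "x \<in> objects G \<Longrightarrow> bd C (idn H x) = idn G x"
  and bd_cmp [simp]: "\<lbrakk>h \<in> arrows H; k \<in> arrows H; tgt H h = tgt H k\<rbrakk>
     \<Longrightarrow> bd C (cmp H h k) = cmp G (bd C h) (bd C k)"
  using morphism_bd by (auto simp: groupoid_morphism_def)

lemma bd_ginv [simp]: "h \<in> arrows H \<Longrightarrow> bd C (ginv H h) = ginv G (bd C h)"
  by (rule groupoid_morphism_ginv[OF top_gpd_H top_gpd_G morphism_bd])

lemma action: "action_by_automorphisms G H (act C)"
  using crossed by (auto simp: groupoid_crossed_module_def Let_def)

lemma cont_act:
  assumes "continuous_map X (Arr H) f" "continuous_map X (Arr G) g"
    and "\<And>x. x \<in> topspace X \<Longrightarrow> tgt H (f x) = tgt G (g x)"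
  shows "continuous_map X (Arr H) (\<lambda>x. act C (f x) (g x))"
proof -
  have "continuous_map X (subtopology (prod_topology (Arr H) (Arr G)) {(h, g). tgt H h = tgt G g})
          (\<lambda>x. (f x, g x))"
    using assms by (intro cont_into continuous_map_pairedI) auto
  moreover have "continuous_map (subtopology (prod_topology (Arr H) (Arr G)) {(h, g). tgt H h = tgt G g})
       (Arr H) (\<lambda>(h, g). act C h g)"
    using action by (simp add: action_by_automorphisms_def)
  ultimately show ?thesis
    by (auto dest: cont_comp)
qed

lemma
  assumes "h \<in> arrows H" "g \<in> arrows G" "tgt H h = tgt G g"
  shows act_in [simp, intro]: "act C h g \<in> arrows H"
    and tgt_act [simp]: "tgt H (act C h g) = src G g"
proof -
  have "homeomorphic_map (subtopology (Arr H) (fibre H (tgt G g)))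
          (subtopology (Arr H) (fibre H (src G g))) (\<lambda>h. act C h g)"
    using action assms by (auto simp: action_by_automorphisms_def)
  from cont_in[OF homeomorphic_imp_continuous_map[OF this]]
  have "act C h g \<in> topspace (subtopology (Arr H) (fibre H (src G g)))"
    using assms by (auto simp: fibre_def)
  then show "act C h g \<in> arrows H" "tgt H (act C h g) = src G g"
    by (auto simp: fibre_def)
qed

lemma act_cmp [simp]:
  "\<lbrakk>g \<in> arrows G; h \<in> arrows H; k \<in> arrows H; tgt H h = tgt G g; tgt H k = tgt G g\<rbrakk>
     \<Longrightarrow> act C (cmp H h k) g = cmp H (act C h g) (act C k g)"
  using action by (auto simp: action_by_automorphisms_def fibre_def)

lemma act_act [simp]:
  "\<lbrakk>g \<in> arrows G; f \<in> arrows G; h \<in> arrows H; tgt H h = tgt G g; src G g = tgt G f\<rbrakk>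
     \<Longrightarrow> act C (act C h g) f = act C h (cmp G g f)"
  using action by (auto simp: action_by_automorphisms_def fibre_def)

lemma act_unit [simp]: "\<lbrakk>h \<in> arrows H; tgt H h = x\<rbrakk> \<Longrightarrow> act C h (idn G x) = h"
  using action H.tgt_in by (auto simp: action_by_automorphisms_def fibre_def)

text \<open>The value is an idempotent of a group.\<close>

lemma unit_act [simp]:
  assumes "g \<in> arrows G" "tgt G g = x"
  shows "act C (idn H x) g = idn H (src G g)"
proof -
  let ?e = "act C (idn H x) g"
  have e: "?e \<in> arrows H" "tgt H ?e = src G g"
    using assms by auto
  have "cmp H ?e ?e = ?e"
    using assms H.idn_in[of x] act_cmp[of g "idn H x" "idn H x"] by auto
  then have "?e = cmp H (ginv H ?e) ?e"
    using e H.cancel_ginv_left[of ?e ?e] by simp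
  then show ?thesis
    using e by simp
qed

lemma act_ginv:
  assumes "g \<in> arrows G" "h \<in> arrows H" "tgt H h = tgt G g"
  shows "act C (ginv H h) g = ginv H (act C h g)"
  using assms by (intro H.ginv_unique) (simp_all flip: act_cmp)

lemma bd_act [simp]:
  "\<lbrakk>g \<in> arrows G; h \<in> arrows H; tgt H h = tgt G g\<rbrakk>
     \<Longrightarrow> bd C (act C h g) = cmp G (ginv G g) (cmp G (bd C h) g)"
  using crossed by (auto simp: groupoid_crossed_module_def Let_def fibre_def)

lemma act_bd:
  "\<lbrakk>h \<in> arrows H; k \<in> arrows H; tgt H h = tgt H k\<rbrakk>
     \<Longrightarrow> act C k (bd C h) = cmp H (ginv H h) (cmp H k h)"
  using crossed H.tgt_in by (auto simp: groupoid_crossed_module_def Let_def fibre_def)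

end

section \<open>The associated 2-groupoid\<close>

abbreviation two_arrows :: "('x, 'g, 'h) xmod \<Rightarrow> ('h \<times> 'g) topology" where
  "two_arrows C \<equiv> subtopology (prod_topology (Arr (xbun C)) (Arr (xgrp C)))
     {p. fst p \<in> fibre (xbun C) (tgt (xgrp C) (snd p))}"

lemma assoc_simps [simp]:
  "one (assoc_2groupoid C) = xgrp C"
  "Obj (vert (assoc_2groupoid C)) = Arr (xgrp C)"
  "Arr (vert (assoc_2groupoid C)) = two_arrows C"
  "src (vert (assoc_2groupoid C)) = snd"
  "tgt (vert (assoc_2groupoid C)) = (\<lambda>p. cmp (xgrp C) (bd C (fst p)) (snd p))"
  "idn (vert (assoc_2groupoid C)) = (\<lambda>g. (idn (xbun C) (tgt (xgrp C) g), g))"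
  "ginv (vert (assoc_2groupoid C)) =
     (\<lambda>p. (ginv (xbun C) (fst p), cmp (xgrp C) (bd C (fst p)) (snd p)))"
  "cmp (vert (assoc_2groupoid C)) = (\<lambda>p q. (cmp (xbun C) (fst p) (fst q), snd q))"
  "Obj (horiz (assoc_2groupoid C)) = Obj (xgrp C)"
  "Arr (horiz (assoc_2groupoid C)) = two_arrows C"
  "src (horiz (assoc_2groupoid C)) = (\<lambda>p. src (xgrp C) (snd p))"
  "tgt (horiz (assoc_2groupoid C)) = (\<lambda>p. tgt (xgrp C) (snd p))"
  "idn (horiz (assoc_2groupoid C)) = (\<lambda>x. (idn (xbun C) x, idn (xgrp C) x))"
  "ginv (horiz (assoc_2groupoid C)) =
     (\<lambda>p. (act C (ginv (xbun C) (fst p)) (snd p), ginv (xgrp C) (snd p)))"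
  "cmp (horiz (assoc_2groupoid C)) =
     (\<lambda>p q. (cmp (xbun C) (fst p) (act C (fst q) (ginv (xgrp C) (snd p))),
             cmp (xgrp C) (snd p) (snd q)))"
  by (simp_all add: assoc_2groupoid_def Let_def fun_eq_iff case_prod_unfold)

context crossed_module
begin

lemma two_arrows_iff [simp]:
  "p \<in> topspace (two_arrows C) \<longleftrightarrow>
     fst p \<in> arrows H \<and> snd p \<in> arrows G \<and> tgt H (fst p) = tgt G (snd p)"
  by (cases p) (auto simp: fibre_def)

lemma cont_two_arrows:
  assumes "continuous_map X (Arr H) f" "continuous_map X (Arr G) g"
    and "\<And>x. x \<in> topspace X \<Longrightarrow> tgt H (f x) = tgt G (g x)"
  shows "continuous_map X (two_arrows C) (\<lambda>x. (f x, g x))"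
  using assms by (intro cont_into continuous_map_pairedI) (auto simp: fibre_def dest: cont_in)

lemma vert_groupoid: "topological_groupoid (vert (assoc_2groupoid C))"
  unfolding topological_groupoid_def
proof (intro conjI, goal_cases)
  case 1
  show ?case by (simp del: topspace_subtopology) (rule cont_pr2)
next
  case 2
  show ?case
    by (simp, intro G.cont_cmp cont_pr2 cont_comp[OF cont_pr1 cont_bd]) (auto simp: fibre_def)
next
  case 3
  show ?case
    by (simp, intro cont_two_arrows cont_comp[OF G.cont_tgt] cont_id)
      (use H.cont_idn in auto)
next
  case 4
  show ?case
    by (simp, intro cont_two_arrows G.cont_cmp cont_pr2 cont_comp[OF cont_pr1 cont_bd] cont_comp[OF cont_pr1 H.cont_ginv])
      (auto simp: fibre_def)
next
  case 5
  show ?case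
    by (simp add: case_prod_unfold, intro cont_two_arrows H.cont_cmp cont_pr11 cont_pr21 cont_pr22)
      (auto simp: fibre_def)
qed (intro ballI impI conjI; simp del: topspace_subtopology)+

lemma horiz_groupoid: "topological_groupoid (horiz (assoc_2groupoid C))"
  unfolding topological_groupoid_def
proof (intro conjI, goal_cases)
  case 1
  show ?case by (simp, rule cont_comp[OF cont_pr2 G.cont_src])
next
  case 2
  show ?case by (simp, rule cont_comp[OF cont_pr2 G.cont_tgt])
next
  case 3
  show ?case
    by (simp, intro cont_two_arrows) (use H.cont_idn G.cont_idn in auto)
next
  case 4
  show ?case
    by (simp, intro cont_two_arrows cont_act cont_comp[OF cont_pr1 H.cont_ginv] cont_comp[OF cont_pr2 G.cont_ginv] cont_pr2)
      (auto simp: fibre_def)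
next
  case 5
  show ?case
    by (simp add: case_prod_unfold, intro cont_two_arrows H.cont_cmp G.cont_cmp cont_act cont_pr11 cont_pr21 cont_pr22 cont_pr12
        cont_comp[OF cont_pr12 G.cont_ginv])
      (auto simp: fibre_def)
qed (intro ballI impI conjI; simp add: act_ginv del: topspace_subtopology)+

text \<open>
  The Peiffer identity in the form used by the interchange law, where the whiskering by the target
  \<open>\<partial>(h)g\<close> of a 2-arrow has to be compared with the whiskering by its source \<open>g\<close>.
\<close>

lemma act_conj [simp]:
  assumes "h \<in> arrows H" "k \<in> arrows H" "g \<in> arrows G" "tgt H h = tgt G g" "tgt H k = src G g"
  shows "act C k (cmp G (ginv G g) (ginv G (bd C h))) = cmp H h (cmp H (act C k (ginv G g)) (ginv H h))"
proof -
  define l where "l = act C k (ginv G g)"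
  have l: "l \<in> arrows H" "tgt H l = tgt H h"
    using assms by (auto simp: l_def)
  have "act C k (cmp G (ginv G g) (ginv G (bd C h))) = act C l (bd C (ginv H h))"
    using assms by (simp add: l_def)
  also have "\<dots> = cmp H h (cmp H l (ginv H h))"
    using assms l by (subst act_bd) auto
  finally show ?thesis
    by (simp add: l_def)
qed

lemma assoc_2groupoid: "topological_2groupoid (assoc_2groupoid C)"
  unfolding topological_2groupoid_def Let_def
  by (intro conjI ballI impI; (simp del: topspace_subtopology)?)
    (simp_all add: top_gpd_G vert_groupoid horiz_groupoid)

end

lemma assoc_hom_simps [simp]:
  "hom0 (assoc_hom \<omega>) = on_obj \<omega>"
  "hom1 (assoc_hom \<omega>) = on_grp \<omega>"
  "homb (assoc_hom \<omega>) = (\<lambda>p. (on_bun \<omega> (fst p), on_grp \<omega> (snd p)))"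
  by (simp_all add: assoc_hom_def split_beta fun_eq_iff)

locale xmod_hom = C: crossed_module C + D: crossed_module D
  for C :: "('x1, 'g1, 'h1) xmod" and D :: "('x2, 'g2, 'h2) xmod" +
  fixes \<omega> :: "('x1, 'g1, 'h1, 'x2, 'g2, 'h2) xmor"
  assumes hom: "xmod_morphism C D \<omega>"
begin

lemma hom_bun: "groupoid_morphism C.H D.H (on_obj \<omega>) (on_bun \<omega>)"
  and hom_grp: "groupoid_morphism C.G D.G (on_obj \<omega>) (on_grp \<omega>)"
  using hom by (auto simp: xmod_morphism_def)

lemma cont_on_obj: "continuous_map (Obj C.G) (Obj D.G) (on_obj \<omega>)"
  and cont_on_grp: "continuous_map (Arr C.G) (Arr D.G) (on_grp \<omega>)"
  and cont_on_bun: "continuous_map (Arr C.H) (Arr D.H) (on_bun \<omega>)"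
  using hom_bun hom_grp by (auto simp: groupoid_morphism_def)

lemma hom_simps [simp]:
  "x \<in> objects C.G \<Longrightarrow> on_obj \<omega> x \<in> objects D.G"
  "g \<in> arrows C.G \<Longrightarrow> on_grp \<omega> g \<in> arrows D.G"
  "h \<in> arrows C.H \<Longrightarrow> on_bun \<omega> h \<in> arrows D.H"
  "g \<in> arrows C.G \<Longrightarrow> src D.G (on_grp \<omega> g) = on_obj \<omega> (src C.G g)"
  "g \<in> arrows C.G \<Longrightarrow> tgt D.G (on_grp \<omega> g) = on_obj \<omega> (tgt C.G g)"
  "h \<in> arrows C.H \<Longrightarrow> tgt D.H (on_bun \<omega> h) = on_obj \<omega> (tgt C.H h)"
  "x \<in> objects C.G \<Longrightarrow> on_grp \<omega> (idn C.G x) = idn D.G (on_obj \<omega> x)"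
  "x \<in> objects C.G \<Longrightarrow> on_bun \<omega> (idn C.H x) = idn D.H (on_obj \<omega> x)"
  "\<lbrakk>g \<in> arrows C.G; f \<in> arrows C.G; src C.G g = tgt C.G f\<rbrakk>
     \<Longrightarrow> on_grp \<omega> (cmp C.G g f) = cmp D.G (on_grp \<omega> g) (on_grp \<omega> f)"
  "\<lbrakk>h \<in> arrows C.H; k \<in> arrows C.H; tgt C.H h = tgt C.H k\<rbrakk>
     \<Longrightarrow> on_bun \<omega> (cmp C.H h k) = cmp D.H (on_bun \<omega> h) (on_bun \<omega> k)"
  "h \<in> arrows C.H \<Longrightarrow> on_grp \<omega> (bd C h) = bd D (on_bun \<omega> h)"
  "\<lbrakk>h \<in> arrows C.H; g \<in> arrows C.G; tgt C.H h = tgt C.G g\<rbrakk>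
     \<Longrightarrow> on_bun \<omega> (act C h g) = act D (on_bun \<omega> h) (on_grp \<omega> g)"
  using hom cont_on_obj[THEN cont_in] cont_on_grp[THEN cont_in] cont_on_bun[THEN cont_in]
  by (auto simp: xmod_morphism_def groupoid_morphism_def fibre_def)

lemma on_grp_ginv [simp]: "g \<in> arrows C.G \<Longrightarrow> on_grp \<omega> (ginv C.G g) = ginv D.G (on_grp \<omega> g)"
  by (rule groupoid_morphism_ginv[OF C.top_gpd_G D.top_gpd_G hom_grp])

lemma cont_homb:
  "continuous_map (two_arrows C) (two_arrows D) (\<lambda>p. (on_bun \<omega> (fst p), on_grp \<omega> (snd p)))"
  by (intro D.cont_two_arrows cont_comp[OF cont_pr1 cont_on_bun] cont_comp[OF cont_pr2 cont_on_grp])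
    (auto simp: fibre_def)

lemma strict_homomorphism:
  "strict_homomorphism (assoc_2groupoid C) (assoc_2groupoid D) (assoc_hom \<omega>)"
  unfolding strict_homomorphism_def groupoid_morphism_def
  using cont_homb cont_on_obj cont_on_grp by (auto simp del: topspace_subtopology)

end

section \<open>Cartesian hypercovers\<close>

text \<open>
  Only the image of \<open>f\<close> matters.  This makes the condition invariant under relabelling and under
  passing to a set of representatives for the fibres of \<open>f\<close>.
\<close>

lemma essentially_surjective_iff:
  "essentially_surjective Z f G \<longleftrightarrow>
     src G ` {\<gamma> \<in> arrows G. tgt G \<gamma> \<in> f ` topspace Z} = objects G"
proof -
  have "(\<lambda>(x, \<gamma>). src G \<gamma>) ` {(x, \<gamma>). x \<in> topspace Z \<and> \<gamma> \<in> arrows G \<and> f x = tgt G \<gamma>}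
      = src G ` {\<gamma> \<in> arrows G. tgt G \<gamma> \<in> f ` topspace Z}" (is "?L = ?R")
  proof (intro equalityI subsetI)
    fix a assume "a \<in> ?R"
    then obtain \<gamma> x where "a = src G \<gamma>" "\<gamma> \<in> arrows G" "x \<in> topspace Z" "f x = tgt G \<gamma>"
      by auto
    then show "a \<in> ?L"
      by (intro image_eqI[of _ _ "(x, \<gamma>)"]) auto
  next
    fix a assume "a \<in> ?L"
    then obtain \<gamma> x where *: "a = src G \<gamma>" "\<gamma> \<in> arrows G" "x \<in> topspace Z" "f x = tgt G \<gamma>"
      by auto
    then have "tgt G \<gamma> \<in> f ` topspace Z"
      by (metis imageI)
    with * show "a \<in> ?R"
      by auto
  qed
  then show ?thesis
    by (simp add: essentially_surjective_def)
qed

definition bd_fibre_product ::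
  "('x, 'g, 'h) xmod \<Rightarrow> ('y, 'm) tgpd \<Rightarrow> ('m \<Rightarrow> 'g) \<Rightarrow> ('h \<times> 'm) topology" where
  "bd_fibre_product D M p =
     subtopology (prod_topology (Arr (xbun D)) (Arr M)) {q. bd D (fst q) = p (snd q)}"

text \<open>
  The last two conditions say that the morphism is full and that \<open>C\<close> is the pullback of the
  crossed module \<open>D\<close> along its functor on arrows.
\<close>

definition cartesian_cover ::
  "('x1, 'g1, 'h1) xmod \<Rightarrow> ('x2, 'g2, 'h2) xmod
     \<Rightarrow> ('x1, 'g1, 'h1, 'x2, 'g2, 'h2) xmor \<Rightarrow> bool" where
  "cartesian_cover C D \<omega> \<longleftrightarrow>
     inj_on (on_obj \<omega>) (objects (xgrp C)) \<and>
     essentially_surjective (Obj (xgrp C)) (on_obj \<omega>) (xgrp D) \<and>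
     (\<forall>x\<in>objects (xgrp C). \<forall>y\<in>objects (xgrp C). \<forall>g\<in>arrows (xgrp D).
        tgt (xgrp D) g = on_obj \<omega> x \<longrightarrow> src (xgrp D) g = on_obj \<omega> y \<longrightarrow>
        (\<exists>m\<in>arrows (xgrp C). tgt (xgrp C) m = x \<and> src (xgrp C) m = y \<and> on_grp \<omega> m = g)) \<and>
     homeomorphic_map (Arr (xbun C)) (bd_fibre_product D (xgrp C) (on_grp \<omega>))
       (\<lambda>h. (on_bun \<omega> h, bd C h))"

context xmod_hom
begin

text \<open>
  A 2-arrow is an element of the bundle together with its source, so the fibre product of 2-arrows
  reduces to that of the boundary map: a pair \<open>(g, g')\<close> over a 2-arrow \<open>b\<close> is parallel by injectivity
  on objects, and \<open>(b, g, g')\<close> corresponds to the lift of \<open>(b, g' g\<^sup>-\<^sup>1)\<close> to the bundle of \<open>C\<close>.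
\<close>

lemma cartesian_cover_homeomorphic_two_arrows:
  assumes inj: "inj_on (on_obj \<omega>) (objects C.G)"
    and cart: "homeomorphic_map (Arr C.H) (bd_fibre_product D C.G (on_grp \<omega>)) (\<lambda>h. (on_bun \<omega> h, bd C h))"
  shows "homeomorphic_map (two_arrows C)
       (subtopology
          (prod_topology (two_arrows D) (prod_topology (Arr C.G) (Arr C.G)))
          {(b, g, g'). snd b = on_grp \<omega> g \<and> cmp D.G (bd D (fst b)) (snd b) = on_grp \<omega> g'})
       (\<lambda>p. ((on_bun \<omega> (fst p), on_grp \<omega> (snd p)), snd p, cmp C.G (bd C (fst p)) (snd p)))"
    (is "homeomorphic_map _ ?Y ?f")
proof -
  from cart obtain l where
    l: "homeomorphic_maps (Arr C.H) (bd_fibre_product D C.G (on_grp \<omega>)) (\<lambda>h. (on_bun \<omega> h, bd C h)) l"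
    by (auto simp: homeomorphic_map_maps)
  let ?u = "\<lambda>y. (fst (fst y), cmp C.G (snd (snd y)) (ginv C.G (fst (snd y))))"
  have l_cont: "continuous_map (bd_fibre_product D C.G (on_grp \<omega>)) (Arr C.H) l"
    and l_left: "\<And>h. h \<in> arrows C.H \<Longrightarrow> l (on_bun \<omega> h, bd C h) = h"
    and l_right: "\<And>q. q \<in> topspace (bd_fibre_product D C.G (on_grp \<omega>))
       \<Longrightarrow> (on_bun \<omega> (l q), bd C (l q)) = q"
    using l by (auto simp: homeomorphic_maps_def)
  have c: "continuous_map ?Y (Arr D.H) (\<lambda>y. fst (fst y))"
    "continuous_map ?Y (Arr C.G) (\<lambda>y. fst (snd y))"
    "continuous_map ?Y (Arr C.G) (\<lambda>y. snd (snd y))"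
    by (rule cont_incl[THEN cont_fst, THEN cont_out, THEN cont_fst],
        rule cont_incl[THEN cont_snd, THEN cont_fst], rule cont_incl[THEN cont_snd, THEN cont_snd])
  \<comment> \<open>The content is in the last two claims: the images of the two arrows are parallel, and
    injectivity on objects lifts this to \<open>C\<close>.\<close>
  have Y: "fst (fst y) \<in> arrows D.H" "fst (snd y) \<in> arrows C.G" "snd (snd y) \<in> arrows C.G"
    "snd (fst y) = on_grp \<omega> (fst (snd y))"
    "cmp D.G (bd D (fst (fst y))) (on_grp \<omega> (fst (snd y))) = on_grp \<omega> (snd (snd y))"
    "tgt D.H (fst (fst y)) = on_obj \<omega> (tgt C.G (fst (snd y)))"
    "src C.G (snd (snd y)) = src C.G (fst (snd y))"
    "tgt C.G (snd (snd y)) = tgt C.G (fst (snd y))" if y: "y \<in> topspace ?Y" for y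
  proof -
    show *: "fst (fst y) \<in> arrows D.H" "fst (snd y) \<in> arrows C.G" "snd (snd y) \<in> arrows C.G"
      "snd (fst y) = on_grp \<omega> (fst (snd y))"
      and cmp: "cmp D.G (bd D (fst (fst y))) (on_grp \<omega> (fst (snd y))) = on_grp \<omega> (snd (snd y))"
      and **: "tgt D.H (fst (fst y)) = on_obj \<omega> (tgt C.G (fst (snd y)))"
      using y by (auto simp: fibre_def)
    have "on_obj \<omega> (src C.G (snd (snd y))) = on_obj \<omega> (src C.G (fst (snd y)))"
      "on_obj \<omega> (tgt C.G (snd (snd y))) = on_obj \<omega> (tgt C.G (fst (snd y)))"
      using arg_cong[OF cmp, of "src D.G"] arg_cong[OF cmp, of "tgt D.G"] * ** by simp_all
    then show "src C.G (snd (snd y)) = src C.G (fst (snd y))"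
      "tgt C.G (snd (snd y)) = tgt C.G (fst (snd y))"
      using inj * by (auto simp: inj_on_def)
  qed
  have u_cont: "continuous_map ?Y (bd_fibre_product D C.G (on_grp \<omega>)) ?u"
    unfolding bd_fibre_product_def
  proof (intro cont_into continuous_map_pairedI c C.G.cont_cmp cont_comp[OF c(2) C.G.cont_ginv])
    fix y assume y: "y \<in> topspace ?Y"
    show "src C.G (snd (snd y)) = tgt C.G (ginv C.G (fst (snd y)))"
      using Y[OF y] by simp
    show "?u y \<in> {q. bd D (fst q) = on_grp \<omega> (snd q)}"
      using Y[OF y] by (simp add: Y(5)[OF y, symmetric])
  qed
  have u: "on_bun \<omega> (l (?u y)) = fst (fst y)" "l (?u y) \<in> arrows C.H"
    "bd C (l (?u y)) = cmp C.G (snd (snd y)) (ginv C.G (fst (snd y)))" if "y \<in> topspace ?Y" for y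
    using l_right[OF cont_in[OF u_cont that]] cont_in[OF l_cont cont_in[OF u_cont that]] by auto
  have tu: "tgt C.H (l (?u y)) = tgt C.G (fst (snd y))" if y: "y \<in> topspace ?Y" for y
  proof -
    have "tgt C.G (bd C (l (?u y))) = tgt C.G (fst (snd y))"
      unfolding u(3)[OF y] using Y[OF y] by simp
    then show ?thesis
      using u(2)[OF y] by simp
  qed
  have "homeomorphic_maps (two_arrows C) ?Y ?f (\<lambda>y. (l (?u y), fst (snd y)))"
    unfolding homeomorphic_maps_def
  proof (intro conjI ballI)
    show "continuous_map (two_arrows C) ?Y ?f"
      by (intro cont_into continuous_map_pairedI cont_homb cont_pr2 C.G.cont_cmp cont_comp[OF cont_pr1 C.cont_bd])
        (auto simp: fibre_def)
    show "continuous_map ?Y (two_arrows C) (\<lambda>y. (l (?u y), fst (snd y)))"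
      by (intro C.cont_two_arrows cont_comp[OF u_cont l_cont] c tu)
    show "(l (?u (?f p)), fst (snd (?f p))) = p" if "p \<in> topspace (two_arrows C)" for p
      using that by (cases p) (simp add: l_left del: topspace_subtopology)
    show "?f (l (?u y), fst (snd y)) = y" if y: "y \<in> topspace ?Y" for y
      using Y[OF y] u[OF y] by (simp add: prod_eq_iff)
  qed
  then show ?thesis
    by (auto simp: homeomorphic_map_maps)
qed

lemma cartesian_cover_hypercover:
  assumes "cartesian_cover C D \<omega>"
  shows "hypercover C D \<omega>"
proof -
  have inj: "inj_on (on_obj \<omega>) (objects C.G)"
    and ess: "essentially_surjective (Obj C.G) (on_obj \<omega>) D.G"
    and full: "\<And>x y g. \<lbrakk>x \<in> objects C.G; y \<in> objects C.G; g \<in> arrows D.G;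
        tgt D.G g = on_obj \<omega> x; src D.G g = on_obj \<omega> y\<rbrakk>
        \<Longrightarrow> \<exists>m\<in>arrows C.G. tgt C.G m = x \<and> src C.G m = y \<and> on_grp \<omega> m = g"
    and cart: "homeomorphic_map (Arr C.H) (bd_fibre_product D C.G (on_grp \<omega>)) (\<lambda>h. (on_bun \<omega> h, bd C h))"
    using assms by (auto simp: cartesian_cover_def)
  have "(\<lambda>(g, b). (tgt C.G g, snd b, src C.G g)) `
         {(g, b). g \<in> arrows C.G \<and> b \<in> topspace (two_arrows D) \<and>
            on_grp \<omega> g = cmp D.G (bd D (fst b)) (snd b)}
       = arrows (pb_groupoid D.G (Obj C.G) (on_obj \<omega>))" (is "?L = ?R")
  proof (intro equalityI subsetI)
    fix q assume "q \<in> ?L"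
    then obtain m h g where q: "q = (tgt C.G m, g, src C.G m)" "m \<in> arrows C.G"
      "h \<in> arrows D.H" "g \<in> arrows D.G" "tgt D.H h = tgt D.G g" "on_grp \<omega> m = cmp D.G (bd D h) g"
      by (auto simp: fibre_def)
    show "q \<in> ?R"
      using q(1-5) arg_cong[OF q(6), of "src D.G"] arg_cong[OF q(6), of "tgt D.G"]
      by (simp add: pb_groupoid_def)
  next
    fix q assume "q \<in> ?R"
    then obtain x g y where q: "q = (x, g, y)" "x \<in> objects C.G" "y \<in> objects C.G" "g \<in> arrows D.G"
      "tgt D.G g = on_obj \<omega> x" "src D.G g = on_obj \<omega> y"
      by (auto simp: pb_groupoid_def)
    with full obtain m where m: "m \<in> arrows C.G" "tgt C.G m = x" "src C.G m = y" "on_grp \<omega> m = g"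
      by metis
    \<comment> \<open>Fullness gives a strict preimage, so an identity 2-arrow suffices.\<close>
    show "q \<in> ?L"
      using q m by (intro image_eqI[of _ _ "(m, (idn D.H (tgt D.G g), g))"]) (auto simp: fibre_def)
  qed
  then show ?thesis
    unfolding hypercover_def weak_equivalence_def
    using hom strict_homomorphism ess cartesian_cover_homeomorphic_two_arrows[OF inj cart]
    by simp
qed

end

lemma (in crossed_module) identity_cartesian_cover:
  defines "\<iota> \<equiv> \<lparr>on_obj = \<lambda>x. x, on_grp = \<lambda>g. g, on_bun = \<lambda>h. h\<rparr>"
  shows "xmod_morphism C C \<iota>" "cartesian_cover C C \<iota>"
proof -
  show "xmod_morphism C C \<iota>"
    by (auto simp: \<iota>_def xmod_morphism_def groupoid_morphism_def cont_id)
  have "homeomorphic_maps (Arr H) (bd_fibre_product C G (\<lambda>g. g)) (\<lambda>h. (h, bd C h)) fst"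
    unfolding homeomorphic_maps_def bd_fibre_product_def
    using cont_incl[THEN cont_fst]
    by (auto intro!: cont_into continuous_map_pairedI cont_bd cont_id)
  then show "cartesian_cover C C \<iota>"
    unfolding cartesian_cover_def essentially_surjective_def
    by (auto simp: \<iota>_def homeomorphic_map_maps intro!: image_eqI[of _ _ "(_, idn G _)"])
qed

lemma constant_xmod_morphism:
  assumes C: "groupoid_crossed_module C" and D: "groupoid_crossed_module D"
    and x: "objects (xgrp C) \<noteq> {} \<Longrightarrow> x \<in> objects (xgrp D)"
  shows "xmod_morphism C D
    \<lparr>on_obj = \<lambda>_. x, on_grp = \<lambda>_. idn (xgrp D) x, on_bun = \<lambda>_. idn (xbun D) x\<rparr>"
proof -
  interpret C: crossed_module C by unfold_locales fact
  interpret D: crossed_module D by unfold_locales fact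
  have "x \<in> objects D.G" if "y \<in> objects C.G" for y
    using x that by blast
  note this [simp] this[OF C.G.src_in, simp] this[OF C.H.src_in[unfolded C.Obj_H], simp]
  show ?thesis
    by (auto simp: xmod_morphism_def groupoid_morphism_def fibre_def
        simp del: continuous_map_const intro!: cont_const)
qed
section \<open>Recognising crossed modules\<close>

text \<open>
  That each arrow acts by a homeomorphism between fibres follows from joint continuity, since the
  inverse arrow acts by the inverse map.
\<close>

lemma crossed_moduleI:
  assumes G: "topological_groupoid (xgrp C)" and H: "topological_groupoid (xbun C)"
    and Obj: "Obj (xbun C) = Obj (xgrp C)"
    and src: "\<And>h. h \<in> arrows (xbun C) \<Longrightarrow> src (xbun C) h = tgt (xbun C) h"
    and bd: "groupoid_morphism (xbun C) (xgrp C) (\<lambda>x. x) (bd C)"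
    and cont_act: "continuous_map
       (subtopology (prod_topology (Arr (xbun C)) (Arr (xgrp C))) {p. tgt (xbun C) (fst p) = tgt (xgrp C) (snd p)})
       (Arr (xbun C)) (\<lambda>p. act C (fst p) (snd p))"
    and tgt_act: "\<And>h g. \<lbrakk>h \<in> arrows (xbun C); g \<in> arrows (xgrp C); tgt (xbun C) h = tgt (xgrp C) g\<rbrakk>
       \<Longrightarrow> tgt (xbun C) (act C h g) = src (xgrp C) g"
    and act_cmp: "\<And>h k g. \<lbrakk>h \<in> arrows (xbun C); k \<in> arrows (xbun C); g \<in> arrows (xgrp C);
         tgt (xbun C) h = tgt (xgrp C) g; tgt (xbun C) k = tgt (xgrp C) g\<rbrakk>
       \<Longrightarrow> act C (cmp (xbun C) h k) g = cmp (xbun C) (act C h g) (act C k g)"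
    and act_act: "\<And>h g f. \<lbrakk>h \<in> arrows (xbun C); g \<in> arrows (xgrp C); f \<in> arrows (xgrp C);
         tgt (xbun C) h = tgt (xgrp C) g; src (xgrp C) g = tgt (xgrp C) f\<rbrakk>
       \<Longrightarrow> act C h (cmp (xgrp C) g f) = act C (act C h g) f"
    and act_unit: "\<And>h. h \<in> arrows (xbun C) \<Longrightarrow> act C h (idn (xgrp C) (tgt (xbun C) h)) = h"
    and bd_act: "\<And>h g. \<lbrakk>h \<in> arrows (xbun C); g \<in> arrows (xgrp C); tgt (xbun C) h = tgt (xgrp C) g\<rbrakk>
       \<Longrightarrow> bd C (act C h g) = cmp (xgrp C) (cmp (xgrp C) (ginv (xgrp C) g) (bd C h)) g"
    and act_bd: "\<And>h k. \<lbrakk>h \<in> arrows (xbun C); k \<in> arrows (xbun C); tgt (xbun C) h = tgt (xbun C) k\<rbrakk>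
       \<Longrightarrow> act C k (bd C h) = cmp (xbun C) (cmp (xbun C) (ginv (xbun C) h) k) h"
  shows "groupoid_crossed_module C"
proof -
  let ?G = "xgrp C" and ?H = "xbun C"
  interpret G: top_gpd ?G by unfold_locales fact
  have cont1: "continuous_map (subtopology (Arr ?H) (fibre ?H (tgt ?G g)))
      (subtopology (Arr ?H) (fibre ?H (src ?G g))) (\<lambda>h. act C h g)" if g: "g \<in> arrows ?G" for g
  proof -
    let ?F = "subtopology (Arr ?H) (fibre ?H (tgt ?G g))"
    have "continuous_map ?F (subtopology (prod_topology (Arr ?H) (Arr ?G))
        {p. tgt ?H (fst p) = tgt ?G (snd p)}) (\<lambda>h. (h, g))"
      using g by (intro cont_into continuous_map_pairedI cont_incl) (auto simp: fibre_def)
    from cont_comp[OF this cont_act] have c: "continuous_map ?F (Arr ?H) (\<lambda>h. act C h g)"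
      by simp
    with cont_in[OF c] show ?thesis
      using g tgt_act by (intro cont_into) (auto simp: fibre_def)
  qed
  have "homeomorphic_map (subtopology (Arr ?H) (fibre ?H (tgt ?G g)))
      (subtopology (Arr ?H) (fibre ?H (src ?G g))) (\<lambda>h. act C h g)" if g: "g \<in> arrows ?G" for g
  proof -
    have "homeomorphic_maps (subtopology (Arr ?H) (fibre ?H (tgt ?G g)))
      (subtopology (Arr ?H) (fibre ?H (src ?G g))) (\<lambda>h. act C h g) (\<lambda>h. act C h (ginv ?G g))"
      unfolding homeomorphic_maps_def
    proof (intro conjI ballI cont1 g)
      show "continuous_map (subtopology (Arr ?H) (fibre ?H (src ?G g)))
          (subtopology (Arr ?H) (fibre ?H (tgt ?G g))) (\<lambda>h. act C h (ginv ?G g))"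
        using cont1[of "ginv ?G g"] g by simp
      show "act C (act C h g) (ginv ?G g) = h"
        if "h \<in> topspace (subtopology (Arr ?H) (fibre ?H (tgt ?G g)))" for h
        using that g act_act[of h g "ginv ?G g"] act_unit[of h] by (simp add: fibre_def)
      show "act C (act C h (ginv ?G g)) g = h"
        if "h \<in> topspace (subtopology (Arr ?H) (fibre ?H (src ?G g)))" for h
        using that g act_act[of h "ginv ?G g" g] act_unit[of h] by (simp add: fibre_def)
    qed
    then show ?thesis
      by (auto simp: homeomorphic_map_maps)
  qed
  then show ?thesis
    unfolding groupoid_crossed_module_def Let_def group_bundle_def action_by_automorphisms_def
    using assms by (auto simp: fibre_def case_prod_unfold)
qed

section \<open>Relabelling along injections\<close>

text \<open>
  Transport of structure along injections, which identifies a topology with its copy on the image.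
  Off the image the inverse maps are arbitrary, which is harmless because only the carriers matter.
\<close>

definition relabel_top :: "('a \<Rightarrow> 'b) \<Rightarrow> 'a topology \<Rightarrow> 'b topology" where
  "relabel_top i T = pullback_topology (range i) (inv i) T"

definition relabel_gpd :: "('x \<Rightarrow> 'y) \<Rightarrow> ('a \<Rightarrow> 'b) \<Rightarrow> ('x, 'a) tgpd \<Rightarrow> ('y, 'b) tgpd" where
  "relabel_gpd i k G =
     \<lparr>Obj = relabel_top i (Obj G),
      Arr = relabel_top k (Arr G),
      src = \<lambda>a. i (src G (inv k a)),
      tgt = \<lambda>a. i (tgt G (inv k a)),
      idn = \<lambda>x. k (idn G (inv i x)),
      ginv = \<lambda>a. k (ginv G (inv k a)),
      cmp = \<lambda>a b. k (cmp G (inv k a) (inv k b))\<rparr>"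

definition relabel_xmod ::
  "('x \<Rightarrow> 'y) \<Rightarrow> ('g \<Rightarrow> 'a) \<Rightarrow> ('h \<Rightarrow> 'b) \<Rightarrow> ('x, 'g, 'h) xmod \<Rightarrow> ('y, 'a, 'b) xmod" where
  "relabel_xmod i k l C =
     \<lparr>xgrp = relabel_gpd i k (xgrp C),
      xbun = relabel_gpd i l (xbun C),
      bd = \<lambda>h. k (bd C (inv l h)),
      act = \<lambda>h g. l (act C (inv l h) (inv k g))\<rparr>"

definition relabel_mor ::
  "('x \<Rightarrow> 'y) \<Rightarrow> ('g \<Rightarrow> 'a) \<Rightarrow> ('h \<Rightarrow> 'b) \<Rightarrow> ('x, 'g, 'h, 'x2, 'g2, 'h2) xmor
     \<Rightarrow> ('y, 'a, 'b, 'x2, 'g2, 'h2) xmor" where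
  "relabel_mor i k l \<omega> =
     \<lparr>on_obj = \<lambda>x. on_obj \<omega> (inv i x), on_grp = \<lambda>g. on_grp \<omega> (inv k g),
      on_bun = \<lambda>h. on_bun \<omega> (inv l h)\<rparr>"

lemma topspace_relabel [simp]: "inj i \<Longrightarrow> topspace (relabel_top i T) = i ` topspace T"
  by (auto simp: relabel_top_def topspace_pullback_topology)

lemma cont_from_relabel: "continuous_map (relabel_top i T) T (inv i)"
  using continuous_map_pullback[OF continuous_map_id, of "range i" "inv i" T]
  by (simp add: relabel_top_def)

lemma cont_to_relabel:
  assumes "inj i" "continuous_map X T f"
  shows "continuous_map X (relabel_top i T) (\<lambda>x. i (f x))"
  unfolding relabel_top_def
  using assms by (intro continuous_map_pullback') (auto simp: o_def)

lemmas cont_relabel = cont_from_relabel[THEN [2] cont_comp]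

lemma relabel_gpd_groupoid:
  assumes "topological_groupoid G" and i: "inj i" and k: "inj k"
  shows "topological_groupoid (relabel_gpd i k G)"
proof -
  interpret G: top_gpd G by unfold_locales fact
  note [simp] = inv_f_f[OF i] inv_f_f[OF k] inj_eq[OF i] topspace_relabel[OF i] topspace_relabel[OF k]
  note r = cont_to_relabel[OF i] cont_to_relabel[OF k]
  show ?thesis
    unfolding topological_groupoid_def relabel_gpd_def tgpd.simps case_prod_unfold
  proof (intro conjI r G.cont_cmp cont_relabel cont_pr1 cont_pr2 cont_comp[OF cont_from_relabel]
      G.cont_src G.cont_tgt G.cont_idn G.cont_ginv, goal_cases)
    case (1 p)
    then show ?case by auto
  qed auto
qed

lemma relabel_gpd_inverse:
  assumes "inj i" "inj k"
  shows "groupoid_morphism (relabel_gpd i k G) G (inv i) (inv k)"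
  using assms cont_from_relabel[of i] cont_from_relabel[of k]
  by (auto simp: groupoid_morphism_def relabel_gpd_def)

lemma relabel_xmod_simps [simp]:
  "xgrp (relabel_xmod i k l C) = relabel_gpd i k (xgrp C)"
  "xbun (relabel_xmod i k l C) = relabel_gpd i l (xbun C)"
  "bd (relabel_xmod i k l C) = (\<lambda>h. k (bd C (inv l h)))"
  "act (relabel_xmod i k l C) = (\<lambda>h g. l (act C (inv l h) (inv k g)))"
  by (simp_all add: relabel_xmod_def)

lemma relabel_gpd_simps:
  "Obj (relabel_gpd i k G) = relabel_top i (Obj G)"
  "Arr (relabel_gpd i k G) = relabel_top k (Arr G)"
  "src (relabel_gpd i k G) = (\<lambda>a. i (src G (inv k a)))"
  "tgt (relabel_gpd i k G) = (\<lambda>a. i (tgt G (inv k a)))"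
  "idn (relabel_gpd i k G) = (\<lambda>x. k (idn G (inv i x)))"
  "ginv (relabel_gpd i k G) = (\<lambda>a. k (ginv G (inv k a)))"
  "cmp (relabel_gpd i k G) = (\<lambda>a b. k (cmp G (inv k a) (inv k b)))"
  by (simp_all add: relabel_gpd_def)

context
  fixes C :: "('x, 'g, 'h) xmod"
    and i :: "'x \<Rightarrow> 'y" and k :: "'g \<Rightarrow> 'a" and l :: "'h \<Rightarrow> 'b"
  assumes C: "groupoid_crossed_module C" and i: "inj i" and k: "inj k" and l: "inj l"
begin

interpretation crossed_module C by unfold_locales (fact C)

lemmas inj_simps = inv_f_f[OF i] inv_f_f[OF k] inv_f_f[OF l] inj_eq[OF i] inj_eq[OF k] inj_eq[OF l]
  topspace_relabel[OF i] topspace_relabel[OF k] topspace_relabel[OF l]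

lemma relabel_crossed_module: "groupoid_crossed_module (relabel_xmod i k l C)"
proof (rule crossed_moduleI; (unfold relabel_xmod_simps)?)
  show "topological_groupoid (relabel_gpd i k G)" "topological_groupoid (relabel_gpd i l H)"
    using top_gpd_G top_gpd_H i k l by (simp_all add: relabel_gpd_groupoid)
  show "groupoid_morphism (relabel_gpd i l H) (relabel_gpd i k G) (\<lambda>x. x) (\<lambda>h. k (bd C (inv l h)))"
    unfolding groupoid_morphism_def relabel_gpd_simps Obj_H
    by (intro conjI cont_to_relabel[OF k] cont_comp[OF cont_from_relabel cont_bd]
        cont_id) (auto simp: inj_simps)
  show "continuous_map
     (subtopology (prod_topology (Arr (relabel_gpd i l H)) (Arr (relabel_gpd i k G)))
       {p. tgt (relabel_gpd i l H) (fst p) = tgt (relabel_gpd i k G) (snd p)})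
     (Arr (relabel_gpd i l H)) (\<lambda>p. l (act C (inv l (fst p)) (inv k (snd p))))"
    unfolding relabel_gpd_simps
    by (intro cont_to_relabel[OF l] cont_act cont_relabel cont_pr1 cont_pr2) (auto simp: inj_simps)
qed (auto simp: relabel_gpd_simps inj_simps act_bd)

lemma relabel_xmod_morphism:
  assumes "xmod_morphism C D \<omega>"
  shows "xmod_morphism (relabel_xmod i k l C) D (relabel_mor i k l \<omega>)"
proof -
  have "groupoid_morphism (relabel_gpd i k G) (xgrp D) (\<lambda>x. on_obj \<omega> (inv i x)) (\<lambda>g. on_grp \<omega> (inv k g))"
    "groupoid_morphism (relabel_gpd i l H) (xbun D) (\<lambda>x. on_obj \<omega> (inv i x)) (\<lambda>g. on_bun \<omega> (inv l g))"
    using assms i k l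
    by (auto simp: xmod_morphism_def intro!: groupoid_morphism_compose[OF relabel_gpd_inverse])
  then show ?thesis
    using assms by (auto simp: xmod_morphism_def relabel_mor_def fibre_def relabel_gpd_simps inj_simps)
qed

lemma relabel_cartesian_cover:
  assumes "cartesian_cover C D \<omega>"
  shows "cartesian_cover (relabel_xmod i k l C) D (relabel_mor i k l \<omega>)"
proof -
  let ?P = "bd_fibre_product D G (on_grp \<omega>)"
  let ?P' = "bd_fibre_product D (relabel_gpd i k G) (\<lambda>g. on_grp \<omega> (inv k g))"
  have "homeomorphic_map (Arr H) ?P (\<lambda>h. (on_bun \<omega> h, bd C h))"
    using assms by (simp add: cartesian_cover_def)
  then obtain u where u: "homeomorphic_maps (Arr H) ?P (\<lambda>h. (on_bun \<omega> h, bd C h)) u"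
    by (auto simp: homeomorphic_map_maps)
  have c: "continuous_map ?P' ?P (\<lambda>q. (fst q, inv k (snd q)))"
    unfolding bd_fibre_product_def relabel_gpd_simps
    by (intro cont_into continuous_map_pairedI cont_relabel cont_pr1 cont_pr2) auto
  have f: "continuous_map (Arr H) (Arr (xbun D)) (on_bun \<omega>)"
    and f': "\<And>h. h \<in> arrows H \<Longrightarrow> bd D (on_bun \<omega> h) = on_grp \<omega> (bd C h)"
    using u cont_fst[of "Arr H" "Arr (xbun D)" "Arr G" "\<lambda>h. (on_bun \<omega> h, bd C h)"]
    by (auto simp: homeomorphic_maps_def bd_fibre_product_def continuous_map_in_subtopology)
  have "homeomorphic_maps (relabel_top l (Arr H)) ?P'
      (\<lambda>h. (on_bun \<omega> (inv l h), k (bd C (inv l h)))) (\<lambda>q. l (u (fst q, inv k (snd q))))"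
    unfolding homeomorphic_maps_def
  proof (intro conjI ballI)
    show "continuous_map (relabel_top l (Arr H)) ?P' (\<lambda>h. (on_bun \<omega> (inv l h), k (bd C (inv l h))))"
      unfolding bd_fibre_product_def relabel_gpd_simps
      by (intro cont_into continuous_map_pairedI cont_to_relabel[OF k] cont_comp[OF cont_from_relabel] f cont_bd)
        (auto simp: inj_simps f')
    show "continuous_map ?P' (relabel_top l (Arr H)) (\<lambda>q. l (u (fst q, inv k (snd q))))"
      using u by (intro cont_to_relabel[OF l] cont_comp[OF c]) (auto simp: homeomorphic_maps_def)
  next
    fix h assume "h \<in> topspace (relabel_top l (Arr H))"
    then show "l (u (fst (on_bun \<omega> (inv l h), k (bd C (inv l h))),
        inv k (snd (on_bun \<omega> (inv l h), k (bd C (inv l h)))))) = h"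
      using u by (auto simp: homeomorphic_maps_def inj_simps)
  next
    fix q assume q: "q \<in> topspace ?P'"
    have "(on_bun \<omega> (u (fst q, inv k (snd q))), bd C (u (fst q, inv k (snd q)))) = (fst q, inv k (snd q))"
      using u cont_in[OF c q] by (simp add: homeomorphic_maps_def)
    moreover have "k (inv k (snd q)) = snd q"
      using q by (auto simp: bd_fibre_product_def relabel_gpd_simps inj_simps)
    ultimately show "(on_bun \<omega> (inv l (l (u (fst q, inv k (snd q))))),
        k (bd C (inv l (l (u (fst q, inv k (snd q))))))) = q"
      by (simp add: inj_simps prod_eq_iff)
  qed
  then have h: "homeomorphic_map (relabel_top l (Arr H)) ?P'
      (\<lambda>h. (on_bun \<omega> (inv l h), k (bd C (inv l h))))"
    by (auto simp: homeomorphic_map_maps)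
  have ess: "essentially_surjective (relabel_top i (Obj G)) (\<lambda>x. on_obj \<omega> (inv i x)) (xgrp D)"
    using assms by (simp add: cartesian_cover_def essentially_surjective_iff inj_simps image_image)
  have "inj_on (\<lambda>x. on_obj \<omega> (inv i x)) (i ` objects G)"
    using assms by (auto simp: cartesian_cover_def inj_on_def inj_simps)
  with assms h ess show ?thesis
    unfolding cartesian_cover_def relabel_mor_def relabel_gpd_simps relabel_xmod_simps
    by (simp add: inj_simps)
qed

lemma relabel_induced_by_crossing:
  assumes "induced_by_crossing K C \<phi> \<psi>"
  shows "induced_by_crossing K (relabel_xmod i k l C) (relabel_mor i k l \<phi>) (relabel_mor i k l \<psi>)"
proof -
  from assms obtain t0 t where t: "groupoid_morphism G (mid K) t0 t"
    and t1: "\<forall>x\<in>objects G. on_obj \<phi> x = tau K (t0 x) \<and> on_obj \<psi> x = sigma K (t0 x)"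
      "\<forall>g\<in>arrows G. alpha2 K (t g) = (t0 (tgt G g), on_grp \<phi> g, t0 (src G g)) \<and>
           beta2 K (t g) = (t0 (tgt G g), on_grp \<psi> g, t0 (src G g))"
      "\<forall>h\<in>arrows H. t (bd C h) = cmp (mid K) (alpha1 K (t0 (tgt H h), on_bun \<phi> h))
                                     (beta1 K (t0 (tgt H h), on_bun \<psi> h))"
    unfolding induced_by_crossing_def Let_def by metis
  have "groupoid_morphism (relabel_gpd i k G) (mid K) (\<lambda>x. t0 (inv i x)) (\<lambda>g. t (inv k g))"
    by (rule groupoid_morphism_compose[OF relabel_gpd_inverse[OF i k] t])
  with t1 show ?thesis
    unfolding induced_by_crossing_def Let_def
    by (intro exI[of _ "\<lambda>x. t0 (inv i x)"] exI[of _ "\<lambda>g. t (inv k g)"])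
      (simp add: relabel_mor_def relabel_gpd_simps inj_simps)
qed

end

lemma relabelled_zigzag:
  assumes C1: "groupoid_crossed_module C1" and C2: "groupoid_crossed_module C2"
    and C: "groupoid_crossed_module C" and \<phi>: "xmod_morphism C C1 \<phi>" "cartesian_cover C C1 \<phi>"
    and \<psi>: "xmod_morphism C C2 \<psi>"
    and ikl: "inj i" "inj k" "inj l"
  defines "C' \<equiv> relabel_xmod i k l C"
    and "\<phi>' \<equiv> relabel_mor i k l \<phi>" and "\<psi>' \<equiv> relabel_mor i k l \<psi>"
  shows "groupoid_crossed_module C' \<and> xmod_morphism C' C1 \<phi>' \<and> xmod_morphism C' C2 \<psi>' \<and>
    hypercover C' C1 \<phi>' \<and>
    weak_homomorphism (assoc_2groupoid C1) (assoc_2groupoid C2)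
             (assoc_2groupoid C') (assoc_hom \<phi>') (assoc_hom \<psi>')"
proof -
  note C' = relabel_crossed_module[OF C ikl, folded C'_def]
  note \<phi>' = relabel_xmod_morphism[OF C ikl \<phi>(1), folded C'_def \<phi>'_def]
  note \<psi>' = relabel_xmod_morphism[OF C ikl \<psi>, folded C'_def \<psi>'_def]
  interpret A: xmod_hom C' C1 \<phi>' by unfold_locales (fact C' C1 \<phi>')+
  interpret B: xmod_hom C' C2 \<psi>' by unfold_locales (fact C' C2 \<psi>')+
  have "hypercover C' C1 \<phi>'"
    unfolding C'_def \<phi>'_def using relabel_cartesian_cover[OF C ikl \<phi>(2)]
    by (metis A.cartesian_cover_hypercover C'_def \<phi>'_def)
  then show ?thesis
    using C' \<phi>' \<psi>' A.C.assoc_2groupoid A.D.assoc_2groupoid B.D.assoc_2groupoid B.strict_homomorphism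
    by (simp add: weak_homomorphism_def hypercover_def)
qed

section \<open>The crossed module of a crossing\<close>

locale crossing_of = C1: crossed_module C1 + C2: crossed_module C2
  for C1 :: "('x1, 'g1, 'h1) xmod" and C2 :: "('x2, 'g2, 'h2) xmod" +
  fixes K :: "('m0, 'm, 'x1, 'g1, 'h1, 'x2, 'g2, 'h2) crossing_data"
  assumes crossing: "crossing C1 C2 K"
begin

abbreviation "M \<equiv> mid K"
abbreviation "\<tau> \<equiv> tau K"
abbreviation "\<sigma> \<equiv> sigma K"

definition to_G1 :: "'m \<Rightarrow> 'g1" where "to_G1 m = fst (snd (alpha2 K m))"
definition to_G2 :: "'m \<Rightarrow> 'g2" where "to_G2 m = fst (snd (beta2 K m))"

lemma top_gpd_M: "topological_groupoid M"
  and cont_tau: "continuous_map (Obj M) (Obj C1.G) \<tau>"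
  and cont_sigma: "continuous_map (Obj M) (Obj C2.G) \<sigma>"
  and mor_alpha1: "groupoid_morphism (pb_bundle C1.H (Obj M) \<tau>) M (\<lambda>z. z) (alpha1 K)"
  and mor_alpha2: "groupoid_morphism M (pb_groupoid C1.G (Obj M) \<tau>) (\<lambda>z. z) (alpha2 K)"
  and mor_beta1: "groupoid_morphism (pb_bundle C2.H (Obj M) \<sigma>) M (\<lambda>z. z) (beta1 K)"
  and mor_beta2: "groupoid_morphism M (pb_groupoid C2.G (Obj M) \<sigma>) (\<lambda>z. z) (beta2 K)"
  and ext: "groupoid_extension (pb_bundle C2.H (Obj M) \<sigma>) M (pb_groupoid C1.G (Obj M) \<tau>)
        (beta1 K) (alpha2 K)"
  using crossing by (auto simp: crossing_def Let_def pb_xmod_def)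

sublocale M: top_gpd "mid K" by unfold_locales (fact top_gpd_M)

lemma tau_in [simp]: "z \<in> objects M \<Longrightarrow> \<tau> z \<in> objects C1.G"
  and sigma_in [simp]: "z \<in> objects M \<Longrightarrow> \<sigma> z \<in> objects C2.G"
  using cont_tau cont_sigma by (auto dest: cont_in)

lemma cont_alpha1:
  assumes "continuous_map X (Obj M) f" "continuous_map X (Arr C1.H) g"
    and "\<And>x. x \<in> topspace X \<Longrightarrow> tgt C1.H (g x) = \<tau> (f x)"
  shows "continuous_map X (Arr M) (\<lambda>x. alpha1 K (f x, g x))"
proof -
  have "continuous_map X (Arr (pb_bundle C1.H (Obj M) \<tau>)) (\<lambda>x. (f x, g x))"
    using assms assms(2)[THEN cont_in]
    by (auto simp: pb_bundle_def fibre_def intro!: cont_into continuous_map_pairedI)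
  moreover have "continuous_map (Arr (pb_bundle C1.H (Obj M) \<tau>)) (Arr M) (alpha1 K)"
    using mor_alpha1 by (simp add: groupoid_morphism_def)
  ultimately show ?thesis
    by (rule cont_comp)
qed

lemma cont_beta1:
  assumes "continuous_map X (Obj M) f" "continuous_map X (Arr C2.H) g"
    and "\<And>x. x \<in> topspace X \<Longrightarrow> tgt C2.H (g x) = \<sigma> (f x)"
  shows "continuous_map X (Arr M) (\<lambda>x. beta1 K (f x, g x))"
proof -
  have "continuous_map X (Arr (pb_bundle C2.H (Obj M) \<sigma>)) (\<lambda>x. (f x, g x))"
    using assms assms(2)[THEN cont_in]
    by (auto simp: pb_bundle_def fibre_def intro!: cont_into continuous_map_pairedI)
  moreover have "continuous_map (Arr (pb_bundle C2.H (Obj M) \<sigma>)) (Arr M) (beta1 K)"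
    using mor_beta1 by (simp add: groupoid_morphism_def)
  ultimately show ?thesis
    by (rule cont_comp)
qed

lemma alpha1_in [simp]: "\<lbrakk>z \<in> objects M; h \<in> arrows C1.H; tgt C1.H h = \<tau> z\<rbrakk> \<Longrightarrow> alpha1 K (z, h) \<in> arrows M"
  using mor_alpha1 unfolding groupoid_morphism_def
  by (auto simp: pb_bundle_def fibre_def dest!: cont_in[where x = "(z, h)"])

lemma beta1_in [simp]: "\<lbrakk>z \<in> objects M; h \<in> arrows C2.H; tgt C2.H h = \<sigma> z\<rbrakk> \<Longrightarrow> beta1 K (z, h) \<in> arrows M"
  using mor_beta1 unfolding groupoid_morphism_def
  by (auto simp: pb_bundle_def fibre_def dest!: cont_in[where x = "(z, h)"])

lemma alpha1_simps [simp]: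
  "\<lbrakk>z \<in> objects M; h \<in> arrows C1.H; tgt C1.H h = \<tau> z\<rbrakk> \<Longrightarrow> src M (alpha1 K (z, h)) = z"
  "\<lbrakk>z \<in> objects M; h \<in> arrows C1.H; tgt C1.H h = \<tau> z\<rbrakk> \<Longrightarrow> tgt M (alpha1 K (z, h)) = z"
  "z \<in> objects M \<Longrightarrow> alpha1 K (z, idn C1.H (\<tau> z)) = idn M z"
  using mor_alpha1 by (auto simp: groupoid_morphism_def pb_bundle_def fibre_def)

lemma alpha1_cmp [simp]:
  assumes "z \<in> objects M" "h \<in> arrows C1.H" "tgt C1.H h = \<tau> z" "k \<in> arrows C1.H" "tgt C1.H k = \<tau> z"
  shows "alpha1 K (z, cmp C1.H h k) = cmp M (alpha1 K (z, h)) (alpha1 K (z, k))"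
proof -
  let ?B = "pb_bundle C1.H (Obj M) \<tau>"
  have "(z, h) \<in> arrows ?B" "(z, k) \<in> arrows ?B" "src ?B (z, h) = tgt ?B (z, k)"
    "cmp ?B (z, h) (z, k) = (z, cmp C1.H h k)"
    using assms by (auto simp: pb_bundle_def fibre_def)
  then show ?thesis
    using mor_alpha1 unfolding groupoid_morphism_def by metis
qed

lemma beta1_simps [simp]:
  "\<lbrakk>z \<in> objects M; h \<in> arrows C2.H; tgt C2.H h = \<sigma> z\<rbrakk> \<Longrightarrow> src M (beta1 K (z, h)) = z"
  "\<lbrakk>z \<in> objects M; h \<in> arrows C2.H; tgt C2.H h = \<sigma> z\<rbrakk> \<Longrightarrow> tgt M (beta1 K (z, h)) = z"
  "z \<in> objects M \<Longrightarrow> beta1 K (z, idn C2.H (\<sigma> z)) = idn M z"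
  using mor_beta1 by (auto simp: groupoid_morphism_def pb_bundle_def fibre_def)

lemma beta1_cmp [simp]:
  assumes "z \<in> objects M" "h \<in> arrows C2.H" "tgt C2.H h = \<sigma> z" "k \<in> arrows C2.H" "tgt C2.H k = \<sigma> z"
  shows "beta1 K (z, cmp C2.H h k) = cmp M (beta1 K (z, h)) (beta1 K (z, k))"
proof -
  let ?B = "pb_bundle C2.H (Obj M) \<sigma>"
  have "(z, h) \<in> arrows ?B" "(z, k) \<in> arrows ?B" "src ?B (z, h) = tgt ?B (z, k)"
    "cmp ?B (z, h) (z, k) = (z, cmp C2.H h k)"
    using assms by (auto simp: pb_bundle_def fibre_def)
  then show ?thesis
    using mor_beta1 unfolding groupoid_morphism_def by metis
qed

lemma alpha2_eq: 
  assumes "m \<in> arrows M"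
  shows "alpha2 K m = (tgt M m, to_G1 m, src M m)" "to_G1 m \<in> arrows C1.G"
    "src C1.G (to_G1 m) = \<tau> (src M m)" "tgt C1.G (to_G1 m) = \<tau> (tgt M m)"
proof -
  have "alpha2 K m \<in> arrows (pb_groupoid C1.G (Obj M) \<tau>)"
    using mor_alpha2 assms by (auto simp: groupoid_morphism_def dest: cont_in)
  moreover have "snd (snd (alpha2 K m)) = src M m" "fst (alpha2 K m) = tgt M m"
    using mor_alpha2 assms by (auto simp: groupoid_morphism_def pb_groupoid_def case_prod_unfold)
  ultimately show "alpha2 K m = (tgt M m, to_G1 m, src M m)" "to_G1 m \<in> arrows C1.G"
    "src C1.G (to_G1 m) = \<tau> (src M m)" "tgt C1.G (to_G1 m) = \<tau> (tgt M m)"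
    by (cases "alpha2 K m"; simp add: pb_groupoid_def to_G1_def)+
qed

lemma beta2_eq: 
  assumes "m \<in> arrows M"
  shows "beta2 K m = (tgt M m, to_G2 m, src M m)" "to_G2 m \<in> arrows C2.G"
    "src C2.G (to_G2 m) = \<sigma> (src M m)" "tgt C2.G (to_G2 m) = \<sigma> (tgt M m)"
proof -
  have "beta2 K m \<in> arrows (pb_groupoid C2.G (Obj M) \<sigma>)"
    using mor_beta2 assms by (auto simp: groupoid_morphism_def dest: cont_in)
  moreover have "snd (snd (beta2 K m)) = src M m" "fst (beta2 K m) = tgt M m"
    using mor_beta2 assms by (auto simp: groupoid_morphism_def pb_groupoid_def case_prod_unfold)
  ultimately show "beta2 K m = (tgt M m, to_G2 m, src M m)" "to_G2 m \<in> arrows C2.G"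
    "src C2.G (to_G2 m) = \<sigma> (src M m)" "tgt C2.G (to_G2 m) = \<sigma> (tgt M m)"
    by (cases "beta2 K m"; simp add: pb_groupoid_def to_G2_def)+
qed

lemmas to_G_simps [simp] = alpha2_eq(2-4) beta2_eq(2-4)

lemma cont_to_G1: "continuous_map (Arr M) (Arr C1.G) to_G1"
  unfolding to_G1_def
  using mor_alpha2[unfolded groupoid_morphism_def, THEN conjunct2, THEN conjunct1]
  by (auto simp: pb_groupoid_def intro: cont_out[THEN cont_snd, THEN cont_fst])

lemma cont_to_G2: "continuous_map (Arr M) (Arr C2.G) to_G2"
  unfolding to_G2_def
  using mor_beta2[unfolded groupoid_morphism_def, THEN conjunct2, THEN conjunct1]
  by (auto simp: pb_groupoid_def intro: cont_out[THEN cont_snd, THEN cont_fst])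

lemma to_G_idn [simp]:
  assumes "z \<in> objects M"
  shows "to_G1 (idn M z) = idn C1.G (\<tau> z)" "to_G2 (idn M z) = idn C2.G (\<sigma> z)"
  using mor_alpha2 mor_beta2 assms
  by (auto simp: groupoid_morphism_def pb_groupoid_def to_G1_def to_G2_def)

lemma to_G_cmp [simp]:
  assumes "m \<in> arrows M" "n \<in> arrows M" "src M m = tgt M n"
  shows "to_G1 (cmp M m n) = cmp C1.G (to_G1 m) (to_G1 n)" "to_G2 (cmp M m n) = cmp C2.G (to_G2 m) (to_G2 n)"
proof -
  have "alpha2 K (cmp M m n) = cmp (pb_groupoid C1.G (Obj M) \<tau>) (alpha2 K m) (alpha2 K n)"
    "beta2 K (cmp M m n) = cmp (pb_groupoid C2.G (Obj M) \<sigma>) (beta2 K m) (beta2 K n)"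
    using mor_alpha2 mor_beta2 assms by (simp_all add: groupoid_morphism_def)
  then show "to_G1 (cmp M m n) = cmp C1.G (to_G1 m) (to_G1 n)" "to_G2 (cmp M m n) = cmp C2.G (to_G2 m) (to_G2 n)"
    by (simp_all add: to_G1_def to_G2_def pb_groupoid_def case_prod_unfold)
qed

lemma to_G1_alpha1 [simp]: "\<lbrakk>z \<in> objects M; h \<in> arrows C1.H; tgt C1.H h = \<tau> z\<rbrakk> \<Longrightarrow> to_G1 (alpha1 K (z, h)) = bd C1 h"
  using crossing by (auto simp: crossing_def Let_def pb_xmod_def pb_bundle_def fibre_def to_G1_def)

lemma to_G2_beta1 [simp]: "\<lbrakk>z \<in> objects M; h \<in> arrows C2.H; tgt C2.H h = \<sigma> z\<rbrakk> \<Longrightarrow> to_G2 (beta1 K (z, h)) = bd C2 h"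
  using crossing by (auto simp: crossing_def Let_def pb_xmod_def pb_bundle_def fibre_def to_G2_def)

lemma to_G2_alpha1 [simp]:
  assumes "z \<in> objects M" "h \<in> arrows C1.H" "tgt C1.H h = \<tau> z"
  shows "to_G2 (alpha1 K (z, h)) = idn C2.G (\<sigma> z)"
proof -
  have "beta2 K (alpha1 K (z, h)) \<in> unit_arrows (pb_groupoid C2.G (Obj M) \<sigma>)"
    using crossing assms by (auto simp: crossing_def Let_def pb_xmod_def pb_bundle_def fibre_def)
  then show ?thesis
    using assms by (auto simp: beta2_eq(1) unit_arrows_def pb_groupoid_def)
qed

lemma to_G1_beta1 [simp]:
  assumes "z \<in> objects M" "h \<in> arrows C2.H" "tgt C2.H h = \<sigma> z"
  shows "to_G1 (beta1 K (z, h)) = idn C1.G (\<tau> z)"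
proof -
  have "alpha2 K (beta1 K (z, h)) \<in> unit_arrows (pb_groupoid C1.G (Obj M) \<tau>)"
    using crossing assms by (auto simp: crossing_def Let_def pb_xmod_def pb_bundle_def fibre_def)
  then show ?thesis
    using assms by (auto simp: alpha2_eq(1) unit_arrows_def pb_groupoid_def)
qed

lemma alpha1_act [simp]:
  assumes "m \<in> arrows M" "h \<in> arrows C1.H" "tgt C1.H h = \<tau> (tgt M m)"
  shows "alpha1 K (src M m, act C1 h (to_G1 m)) = cmp M (ginv M m) (cmp M (alpha1 K (tgt M m, h)) m)"
proof -
  have "alpha1 K (act (pb_xmod C1 (Obj M) \<tau>) (tgt M m, h) (alpha2 K m)) =
      cmp M (cmp M (ginv M m) (alpha1 K (tgt M m, h))) m"
    using crossing assms M.tgt_in by (auto simp: crossing_def Let_def pb_xmod_def pb_bundle_def fibre_def)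
  then show ?thesis
    using assms by (simp add: pb_xmod_def alpha2_eq(1))
qed

lemma beta1_act [simp]:
  assumes "m \<in> arrows M" "h \<in> arrows C2.H" "tgt C2.H h = \<sigma> (tgt M m)"
  shows "beta1 K (src M m, act C2 h (to_G2 m)) = cmp M (ginv M m) (cmp M (beta1 K (tgt M m, h)) m)"
proof -
  have "beta1 K (act (pb_xmod C2 (Obj M) \<sigma>) (tgt M m, h) (beta2 K m)) =
      cmp M (cmp M (ginv M m) (beta1 K (tgt M m, h))) m"
    using crossing assms M.tgt_in by (auto simp: crossing_def Let_def pb_xmod_def pb_bundle_def fibre_def)
  then show ?thesis
    using assms by (simp add: pb_xmod_def beta2_eq(1))
qed

text \<open>
  Conjugating \<open>\<beta>\<^sub>1(k)\<close> by \<open>\<alpha>\<^sub>1(h)\<close> amounts to acting on \<open>k\<close> by \<open>\<beta>\<^sub>2(\<alpha>\<^sub>1(h))\<close>, which is a unit.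
\<close>

lemma alpha1_beta1_commute:
  assumes "z \<in> objects M" "h \<in> arrows C1.H" "tgt C1.H h = \<tau> z" "k \<in> arrows C2.H" "tgt C2.H k = \<sigma> z"
  shows "cmp M (beta1 K (z, k)) (alpha1 K (z, h)) = cmp M (alpha1 K (z, h)) (beta1 K (z, k))"
proof -
  let ?a = "alpha1 K (z, h)" and ?b = "beta1 K (z, k)"
  have "?b = cmp M (ginv M ?a) (cmp M ?b ?a)"
    using beta1_act[of ?a k] assms by simp
  then have "cmp M ?a ?b = cmp M ?a (cmp M (ginv M ?a) (cmp M ?b ?a))"
    by simp
  then show ?thesis
    using assms by simp
qed

text \<open>
  Exactness of the extension turns arrows in the kernel of \<open>\<alpha>\<^sub>2\<close> into elements of the bundle of
  \<open>C2\<close>, continuously since \<open>\<beta>\<^sub>1\<close> is an embedding.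
\<close>

lemma beta1_inverse:
  obtains \<kappa> where
    "continuous_map
      (subtopology (Arr M) {m. src M m = tgt M m \<and> to_G1 m = idn C1.G (\<tau> (tgt M m))}) (Arr C2.H) \<kappa>"
    "\<And>z h. \<lbrakk>z \<in> objects M; h \<in> arrows C2.H; tgt C2.H h = \<sigma> z\<rbrakk> \<Longrightarrow> \<kappa> (beta1 K (z, h)) = h"
    "\<And>m. \<lbrakk>m \<in> arrows M; src M m = tgt M m; to_G1 m = idn C1.G (\<tau> (tgt M m))\<rbrakk>
        \<Longrightarrow> \<kappa> m \<in> arrows C2.H \<and> tgt C2.H (\<kappa> m) = \<sigma> (tgt M m) \<and> beta1 K (tgt M m, \<kappa> m) = m"
proof -
  let ?P = "pb_bundle C2.H (Obj M) \<sigma>"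
  have img: "beta1 K ` arrows ?P = {m \<in> arrows M. alpha2 K m \<in> unit_arrows (pb_groupoid C1.G (Obj M) \<tau>)}"
    and emb: "embedding_map (Arr ?P) (Arr M) (beta1 K)"
    using ext by (auto simp: groupoid_extension_def)
  have ker: "m \<in> beta1 K ` arrows ?P" if "m \<in> arrows M" "src M m = tgt M m" "to_G1 m = idn C1.G (\<tau> (tgt M m))" for m
    unfolding img using that M.tgt_in by (auto simp: alpha2_eq(1) unit_arrows_def pb_groupoid_def)
  from emb obtain u where u: "homeomorphic_maps (Arr ?P) (subtopology (Arr M) (beta1 K ` arrows ?P)) (beta1 K) u"
    by (auto simp: embedding_map_def homeomorphic_map_maps)
  then have u_cont: "continuous_map (subtopology (Arr M) (beta1 K ` arrows ?P)) (Arr ?P) u"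
    and u1: "\<And>q. q \<in> arrows ?P \<Longrightarrow> u (beta1 K q) = q"
    and u2: "\<And>m. m \<in> arrows M \<Longrightarrow> m \<in> beta1 K ` arrows ?P \<Longrightarrow> beta1 K (u m) = m"
    by (auto simp: homeomorphic_maps_def)
  show thesis
  proof (rule that[of "\<lambda>m. snd (u m)"])
    let ?k = "subtopology (Arr M) {m. src M m = tgt M m \<and> to_G1 m = idn C1.G (\<tau> (tgt M m))}"
    have "continuous_map ?k (Arr ?P) u"
      by (intro cont_comp[OF _ u_cont] cont_into cont_incl ker) auto
    then show "continuous_map ?k (Arr C2.H) (\<lambda>m. snd (u m))"
      by (auto simp: pb_bundle_def intro: cont_out[THEN cont_snd])
  next
    fix z h assume "z \<in> objects M" "h \<in> arrows C2.H" "tgt C2.H h = \<sigma> z"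
    then show "snd (u (beta1 K (z, h))) = h"
      by (subst u1) (auto simp: pb_bundle_def fibre_def)
  next
    fix m assume m: "m \<in> arrows M" "src M m = tgt M m" "to_G1 m = idn C1.G (\<tau> (tgt M m))"
    have um: "u m \<in> arrows ?P" "beta1 K (u m) = m"
      using cont_in[OF u_cont] u2 ker[OF m] m(1) by auto
    then obtain z h where zh: "u m = (z, h)" "z \<in> objects M" "h \<in> arrows C2.H" "tgt C2.H h = \<sigma> z"
      by (auto simp: pb_bundle_def fibre_def)
    then show "snd (u m) \<in> arrows C2.H \<and> tgt C2.H (snd (u m)) = \<sigma> (tgt M m) \<and>
        beta1 K (tgt M m, snd (u m)) = m"
      using um(2) beta1_simps(2)[of z h] by auto
  qed
qed

lemma alpha2_surjective:
  assumes "x \<in> objects M" "y \<in> objects M" "g \<in> arrows C1.G" "tgt C1.G g = \<tau> x" "src C1.G g = \<tau> y"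
  shows "\<exists>m\<in>arrows M. tgt M m = x \<and> src M m = y \<and> to_G1 m = g"
proof -
  have "(x, g, y) \<in> alpha2 K ` arrows M"
    using ext assms by (auto simp: groupoid_extension_def pb_groupoid_def)
  then show ?thesis
    using alpha2_eq(1) by auto
qed

end

definition restrict_gpd :: "('x, 'a) tgpd \<Rightarrow> 'x set \<Rightarrow> ('x, 'a) tgpd" where
  "restrict_gpd G S =
     G\<lparr>Obj := subtopology (Obj G) S, Arr := subtopology (Arr G) {g. src G g \<in> S \<and> tgt G g \<in> S}\<rparr>"

lemma restrict_gpd_simps [simp]:
  "Obj (restrict_gpd G S) = subtopology (Obj G) S"
  "Arr (restrict_gpd G S) = subtopology (Arr G) {g. src G g \<in> S \<and> tgt G g \<in> S}"
  "src (restrict_gpd G S) = src G"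
  "tgt (restrict_gpd G S) = tgt G"
  "idn (restrict_gpd G S) = idn G"
  "ginv (restrict_gpd G S) = ginv G"
  "cmp (restrict_gpd G S) = cmp G"
  by (simp_all add: restrict_gpd_def)

lemma restrict_gpd_groupoid:
  assumes "topological_groupoid G"
  shows "topological_groupoid (restrict_gpd G S)"
proof -
  interpret G: top_gpd G by unfold_locales fact
  show ?thesis
    unfolding topological_groupoid_def restrict_gpd_simps case_prod_unfold
  proof (intro conjI cont_into G.cont_cmp cont_pr1[THEN cont_out] cont_pr2[THEN cont_out]
      cont_comp[OF cont_incl G.cont_src] cont_comp[OF cont_incl G.cont_tgt]
      cont_comp[OF cont_incl G.cont_idn] cont_comp[OF cont_incl G.cont_ginv])
  qed auto
qed

text \<open>
  The crossed module of the crossing, restricted to the objects in \<open>S\<close>.  Elements of the bundle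
  are triples of an object of the crossing and one element of each of the two bundles above its images.
\<close>

definition fibre_product_xmod ::
  "('x1, 'g1, 'h1) xmod \<Rightarrow> ('x2, 'g2, 'h2) xmod
     \<Rightarrow> ('m0, 'm, 'x1, 'g1, 'h1, 'x2, 'g2, 'h2) crossing_data \<Rightarrow> 'm0 set
     \<Rightarrow> ('m0, 'm, 'm0 \<times> 'h1 \<times> 'h2) xmod" where
  "fibre_product_xmod C1 C2 K S =
     \<lparr>xgrp = restrict_gpd (mid K) S,
      xbun =
        \<lparr>Obj = subtopology (Obj (mid K)) S,
         Arr = subtopology (prod_topology (Obj (mid K)) (prod_topology (Arr (xbun C1)) (Arr (xbun C2))))
           {q. fst q \<in> S \<and> tgt (xbun C1) (fst (snd q)) = tau K (fst q) \<and>
               tgt (xbun C2) (snd (snd q)) = sigma K (fst q)},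
         src = fst,
         tgt = fst,
         idn = \<lambda>z. (z, idn (xbun C1) (tau K z), idn (xbun C2) (sigma K z)),
         ginv = \<lambda>q. (fst q, ginv (xbun C1) (fst (snd q)), ginv (xbun C2) (snd (snd q))),
         cmp = \<lambda>q r. (fst q, cmp (xbun C1) (fst (snd q)) (fst (snd r)),
                         cmp (xbun C2) (snd (snd q)) (snd (snd r)))\<rparr>,
      bd = \<lambda>q. cmp (mid K) (alpha1 K (fst q, fst (snd q))) (beta1 K (fst q, snd (snd q))),
      act = \<lambda>q m. (src (mid K) m, act C1 (fst (snd q)) (fst (snd (alpha2 K m))),
                     act C2 (snd (snd q)) (fst (snd (beta2 K m))))\<rparr>"

lemma fibre_product_simps:
  "xgrp (fibre_product_xmod C1 C2 K S) = restrict_gpd (mid K) S"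
  "Obj (xbun (fibre_product_xmod C1 C2 K S)) = subtopology (Obj (mid K)) S"
  "Arr (xbun (fibre_product_xmod C1 C2 K S)) =
     subtopology (prod_topology (Obj (mid K)) (prod_topology (Arr (xbun C1)) (Arr (xbun C2))))
           {q. fst q \<in> S \<and> tgt (xbun C1) (fst (snd q)) = tau K (fst q) \<and>
               tgt (xbun C2) (snd (snd q)) = sigma K (fst q)}"
  "src (xbun (fibre_product_xmod C1 C2 K S)) = fst"
  "tgt (xbun (fibre_product_xmod C1 C2 K S)) = fst"
  "idn (xbun (fibre_product_xmod C1 C2 K S)) = (\<lambda>z. (z, idn (xbun C1) (tau K z), idn (xbun C2) (sigma K z)))"
  "ginv (xbun (fibre_product_xmod C1 C2 K S)) =
     (\<lambda>q. (fst q, ginv (xbun C1) (fst (snd q)), ginv (xbun C2) (snd (snd q))))"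
  "cmp (xbun (fibre_product_xmod C1 C2 K S)) =
     (\<lambda>q r. (fst q, cmp (xbun C1) (fst (snd q)) (fst (snd r)), cmp (xbun C2) (snd (snd q)) (snd (snd r))))"
  "bd (fibre_product_xmod C1 C2 K S) =
     (\<lambda>q. cmp (mid K) (alpha1 K (fst q, fst (snd q))) (beta1 K (fst q, snd (snd q))))"
  "act (fibre_product_xmod C1 C2 K S) =
     (\<lambda>q m. (src (mid K) m, act C1 (fst (snd q)) (fst (snd (alpha2 K m))),
            act C2 (snd (snd q)) (fst (snd (beta2 K m)))))"
  by (simp_all add: fibre_product_xmod_def)

locale crossing_restricted = crossing_of C1 C2 K
  for C1 :: "('x1, 'g1, 'h1) xmod" and C2 :: "('x2, 'g2, 'h2) xmod"
    and K :: "('m0, 'm, 'x1, 'g1, 'h1, 'x2, 'g2, 'h2) crossing_data" +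
  fixes S :: "'m0 set"
begin

abbreviation "N \<equiv> fibre_product_xmod C1 C2 K S"

lemmas N_simps = fibre_product_simps[where ?C1.0 = C1 and ?C2.0 = C2 and K = K and S = S, folded to_G1_def to_G2_def]

lemma cont_N_bun:
  assumes "continuous_map X (Arr (xbun N)) f"
  shows "continuous_map X (Obj M) (\<lambda>x. fst (f x))"
    "continuous_map X (Arr C1.H) (\<lambda>x. fst (snd (f x)))"
    "continuous_map X (Arr C2.H) (\<lambda>x. snd (snd (f x)))"
  using assms[unfolded N_simps, THEN cont_out]
  by (auto intro: cont_fst cont_snd)

lemma cont_into_N_bun:
  assumes "continuous_map X (Obj M) f" "continuous_map X (Arr C1.H) g" "continuous_map X (Arr C2.H) h"
    and "\<And>x. x \<in> topspace X \<Longrightarrow> f x \<in> S"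
    and "\<And>x. x \<in> topspace X \<Longrightarrow> tgt C1.H (g x) = \<tau> (f x)"
    and "\<And>x. x \<in> topspace X \<Longrightarrow> tgt C2.H (h x) = \<sigma> (f x)"
  shows "continuous_map X (Arr (xbun N)) (\<lambda>x. (f x, g x, h x))"
  unfolding N_simps using assms by (intro cont_into continuous_map_pairedI) auto

lemma N_bun_iff [simp]:
  "(z, h, k) \<in> arrows (xbun N) \<longleftrightarrow> z \<in> objects M \<and> z \<in> S \<and> h \<in> arrows C1.H \<and> tgt C1.H h = \<tau> z \<and>
     k \<in> arrows C2.H \<and> tgt C2.H k = \<sigma> z"
  by (auto simp: N_simps)

lemma N_bunD:
  assumes "q \<in> arrows (xbun N)"
  shows "fst q \<in> objects M" "fst q \<in> S" "fst (snd q) \<in> arrows C1.H" "tgt C1.H (fst (snd q)) = \<tau> (fst q)"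
     "snd (snd q) \<in> arrows C2.H" "tgt C2.H (snd (snd q)) = \<sigma> (fst q)"
  using assms N_bun_iff[of "fst q" "fst (snd q)" "snd (snd q)"] by simp_all

lemma N_bun_groupoid: "topological_groupoid (xbun N)"
proof -
  note s = N_simps(2, 4-8)
  note c = cont_N_bun[OF cont_id] cont_N_bun[OF cont_pr1] cont_N_bun[OF cont_pr2]
  show ?thesis
    unfolding topological_groupoid_def s case_prod_unfold
  proof (intro conjI ballI impI, goal_cases)
    case 1 show ?case by (intro cont_into c) (simp add: N_bunD)
  next
    case 2 show ?case by (intro cont_into c) (simp add: N_bunD)
  next
    case 3 show ?case
      by (intro cont_into_N_bun cont_incl cont_comp[OF cont_incl] cont_comp[OF cont_tau] cont_comp[OF cont_sigma])
        (use C1.H.cont_idn C2.H.cont_idn in auto)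
  next
    case 4 show ?case
      by (intro cont_into_N_bun c cont_comp[OF c(2) C1.H.cont_ginv] cont_comp[OF c(3) C2.H.cont_ginv])
       (simp_all add: N_bunD)
  next
    case 5 show ?case
      by (intro cont_into_N_bun c C1.H.cont_cmp C2.H.cont_cmp) (auto simp: N_bunD)
  qed (auto simp: N_bunD)
qed

lemma morphism_N_bd: "groupoid_morphism (xbun N) (xgrp N) (\<lambda>x. x) (bd N)"
proof -
  note c = cont_N_bun[OF cont_id]
  have 1: "continuous_map (Arr (xbun N)) (Arr M) (bd N)"
    unfolding N_simps(9)
    by (intro M.cont_cmp cont_alpha1 cont_beta1 c) (simp_all add: N_bunD)
  have 2: "continuous_map (Arr (xbun N)) (Arr (xgrp N)) (bd N)"
    unfolding N_simps(1) restrict_gpd_simps using 1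
    by (intro cont_into) (simp_all add: N_bunD N_simps(9))
  have 3: "bd N (cmp (xbun N) q r) = cmp M (bd N q) (bd N r)"
    if q: "q \<in> arrows (xbun N)" and r: "r \<in> arrows (xbun N)" and eq: "fst q = fst r" for q r
  proof -
    obtain z h k where [simp]: "q = (z, h, k)" by (metis prod.exhaust)
    obtain h' k' where [simp]: "r = (z, h', k')" using eq by (cases r) auto
    \<comment> \<open>The middle two factors of \<open>\<alpha>\<^sub>1(h) \<beta>\<^sub>1(k) \<alpha>\<^sub>1(h') \<beta>\<^sub>1(k')\<close> are exchanged.\<close>
    have *: "cmp M (beta1 K (z, k)) (cmp M (alpha1 K (z, h')) (beta1 K (z, k'))) =
      cmp M (alpha1 K (z, h')) (cmp M (beta1 K (z, k)) (beta1 K (z, k')))"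
      using q r alpha1_beta1_commute[of z h' k] M.assoc[of "beta1 K (z, k)" "alpha1 K (z, h')" "beta1 K (z, k')"]
      by (simp flip: M.assoc)
    show ?thesis
      using q r * by (simp add: N_simps(8,9))
  qed
  show ?thesis
    unfolding groupoid_morphism_def
    using 2 3 by (simp add: N_simps(1,2,4-6,9) N_bunD cont_id)
qed

text \<open>
  Both crossed module identities hold coordinatewise: \<open>\<alpha>\<^sub>1\<close> and \<open>\<beta>\<^sub>1\<close> are equivariant, and \<open>\<alpha>\<^sub>2\<close> and
  \<open>\<beta>\<^sub>2\<close> send \<open>\<alpha>\<^sub>1(h) \<beta>\<^sub>1(k)\<close> to \<open>\<partial>\<^sub>1(h)\<close> and \<open>\<partial>\<^sub>2(k)\<close>, so that the Peiffer identity is inherited from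
  the two given crossed modules.
\<close>

lemma N_crossed_module: "groupoid_crossed_module N"
proof (rule crossed_moduleI)
  show "topological_groupoid (xgrp N)"
    unfolding N_simps by (rule restrict_gpd_groupoid[OF top_gpd_M])
  show "groupoid_morphism (xbun N) (xgrp N) (\<lambda>x. x) (bd N)"
    by (rule morphism_N_bd)
  show "topological_groupoid (xbun N)"
    by (rule N_bun_groupoid)
  show "Obj (xbun N) = Obj (xgrp N)"
    by (simp add: N_simps)
  let ?X = "subtopology (prod_topology (Arr (xbun N)) (Arr (xgrp N))) {p. tgt (xbun N) (fst p) = tgt (xgrp N) (snd p)}"
  note c = cont_N_bun[OF cont_pr1] 
  have m: "continuous_map ?X (Arr M) snd"
    unfolding N_simps(1) restrict_gpd_simps by (rule cont_incl[THEN cont_snd, THEN cont_out])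
  show "continuous_map ?X (Arr (xbun N)) (\<lambda>p. act N (fst p) (snd p))"
    unfolding N_simps(10)
    by (intro cont_into_N_bun C1.cont_act C2.cont_act c cont_comp[OF m cont_to_G1] cont_comp[OF m cont_to_G2]
        cont_comp[OF m M.cont_src]) (auto simp: N_bunD N_simps(1,5))
next
  fix q m assume q: "q \<in> arrows (xbun N)" and m: "m \<in> arrows (xgrp N)" and t: "tgt (xbun N) q = tgt (xgrp N) m"
  obtain h k where [simp]: "q = (tgt M m, h, k)"
    using t by (cases q) (auto simp: N_simps(1,5))
  have [simp]: "m \<in> arrows M" "src M m \<in> S" "tgt M m \<in> S" 
    using m by (auto simp: N_simps)
  show "tgt (xbun N) (act N q m) = src (xgrp N) m"
    by (simp add: N_simps)
  show "bd N (act N q m) = cmp (xgrp N) (cmp (xgrp N) (ginv (xgrp N) m) (bd N q)) m"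
    using q by (simp add: N_simps(1,9,10))
  show "act N (cmp (xbun N) q r) m = cmp (xbun N) (act N q m) (act N r m)"
    if r: "r \<in> arrows (xbun N)" "tgt (xbun N) r = tgt (xgrp N) m" for r
    using q N_bunD[OF r(1)] r(2) by (simp add: N_simps(1,5,8,10))
  show "act N q (cmp (xgrp N) m n) = act N (act N q m) n"
    if n: "n \<in> arrows (xgrp N)" "src (xgrp N) m = tgt (xgrp N) n" for n
    using n q by (simp add: N_simps(1,10))
next
  fix q r assume q: "q \<in> arrows (xbun N)" and r: "r \<in> arrows (xbun N)" and t: "tgt (xbun N) q = tgt (xbun N) r"
  obtain z h k where [simp]: "q = (z, h, k)" by (metis prod.exhaust)
  obtain h' k' where [simp]: "r = (z, h', k')" using t by (cases r) (auto simp: N_simps(5))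
  show "act N r (bd N q) = cmp (xbun N) (cmp (xbun N) (ginv (xbun N) q) r) q"
    using q r by (simp add: N_simps(7-10) C1.act_bd C2.act_bd)
next
  fix q assume q: "q \<in> arrows (xbun N)"
  then show "src (xbun N) q = tgt (xbun N) q" "act N q (idn (xgrp N) (tgt (xbun N) q)) = q"
    by (simp_all add: N_simps(1,4,5,10) N_bunD)
qed

definition leg1 :: "('m0, 'm, 'm0 \<times> 'h1 \<times> 'h2, 'x1, 'g1, 'h1) xmor" where
  "leg1 = \<lparr>on_obj = \<tau>, on_grp = to_G1, on_bun = \<lambda>q. fst (snd q)\<rparr>"

definition leg2 :: "('m0, 'm, 'm0 \<times> 'h1 \<times> 'h2, 'x2, 'g2, 'h2) xmor" where
  "leg2 = \<lparr>on_obj = \<sigma>, on_grp = to_G2, on_bun = \<lambda>q. snd (snd q)\<rparr>"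

lemma leg_simps [simp]:
  "on_obj leg1 = \<tau>" "on_grp leg1 = to_G1" "on_bun leg1 = (\<lambda>q. fst (snd q))"
  "on_obj leg2 = \<sigma>" "on_grp leg2 = to_G2" "on_bun leg2 = (\<lambda>q. snd (snd q))"
  by (simp_all add: leg1_def leg2_def)

lemma leg1_morphism: "xmod_morphism N C1 leg1"
  unfolding xmod_morphism_def groupoid_morphism_def leg_simps
proof (intro conjI)
  show "continuous_map (Arr (xbun N)) (Arr C1.H) (\<lambda>q. fst (snd q))"
    by (rule cont_N_bun[OF cont_id])
qed (auto simp: N_simps(1,2,4-6,8-10) N_bunD fibre_def
    intro: cont_comp[OF cont_incl cont_tau] cont_comp[OF cont_incl cont_to_G1])

lemma leg2_morphism: "xmod_morphism N C2 leg2"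
  unfolding xmod_morphism_def groupoid_morphism_def leg_simps
proof (intro conjI)
  show "continuous_map (Arr (xbun N)) (Arr C2.H) (\<lambda>q. snd (snd q))"
    by (rule cont_N_bun[OF cont_id])
qed (auto simp: N_simps(1,2,4-6,8-10) N_bunD fibre_def
    intro: cont_comp[OF cont_incl cont_sigma] cont_comp[OF cont_incl cont_to_G2])

lemma N_induced: "induced_by_crossing K N leg1 leg2"
  unfolding induced_by_crossing_def Let_def
  by (intro exI[of _ "\<lambda>z. z"] exI[of _ "\<lambda>m. m"])
    (auto simp: groupoid_morphism_def N_simps(1,5,9) cont_incl alpha2_eq(1) beta2_eq(1))

text \<open>
  Injectivity of \<open>\<tau>\<close> on \<open>S\<close> makes every \<open>m\<close> with \<open>\<alpha>\<^sub>2(m) = \<partial>\<^sub>1(h)\<close> a loop, so that \<open>\<alpha>\<^sub>1(h)\<close> is defined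
  over its base point and \<open>m\<close> factors uniquely as \<open>\<alpha>\<^sub>1(h) \<beta>\<^sub>1(k)\<close>.  Fullness is surjectivity of \<open>\<alpha>\<^sub>2\<close>.
\<close>

lemma N_cartesian_cover:
  assumes S: "S \<subseteq> objects M" and inj: "inj_on \<tau> S" and img: "\<tau> ` S = \<tau> ` objects M"
    and ess: "essentially_surjective (Obj M) \<tau> C1.G"
  shows "cartesian_cover N C1 leg1"
proof -
  let ?P = "bd_fibre_product C1 (xgrp N) to_G1"
  obtain \<kappa> where
    \<kappa>_cont: "continuous_map
      (subtopology (Arr M) {m. src M m = tgt M m \<and> to_G1 m = idn C1.G (\<tau> (tgt M m))}) (Arr C2.H) \<kappa>"
    and \<kappa>_left: "\<And>z h. \<lbrakk>z \<in> objects M; h \<in> arrows C2.H; tgt C2.H h = \<sigma> z\<rbrakk> \<Longrightarrow> \<kappa> (beta1 K (z, h)) = h"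
    and \<kappa>: "\<And>m. \<lbrakk>m \<in> arrows M; src M m = tgt M m; to_G1 m = idn C1.G (\<tau> (tgt M m))\<rbrakk>
        \<Longrightarrow> \<kappa> m \<in> arrows C2.H \<and> tgt C2.H (\<kappa> m) = \<sigma> (tgt M m) \<and> beta1 K (tgt M m, \<kappa> m) = m"
    using beta1_inverse by blast
  let ?r = "\<lambda>y. cmp M (ginv M (alpha1 K (tgt M (snd y), fst y))) (snd y)"
  have P: "fst y \<in> arrows C1.H" "snd y \<in> arrows M" "tgt M (snd y) \<in> S" "bd C1 (fst y) = to_G1 (snd y)"
      "tgt C1.H (fst y) = \<tau> (tgt M (snd y))" "src M (snd y) = tgt M (snd y)"
    if y: "y \<in> topspace ?P" for y
  proof -
    show *: "fst y \<in> arrows C1.H" "snd y \<in> arrows M" "tgt M (snd y) \<in> S" 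
      and bd: "bd C1 (fst y) = to_G1 (snd y)"
      using y by (auto simp: bd_fibre_product_def N_simps(1))
    have s: "src M (snd y) \<in> S"
      using y by (auto simp: bd_fibre_product_def N_simps(1))
    show "tgt C1.H (fst y) = \<tau> (tgt M (snd y))"
      using arg_cong[OF bd, of "tgt C1.G"] * by simp
    moreover have "tgt C1.H (fst y) = \<tau> (src M (snd y))"
      using arg_cong[OF bd, of "src C1.G"] * by simp
    ultimately show "src M (snd y) = tgt M (snd y)"
      using inj s *(3) by (auto simp: inj_on_def)
  qed
  have r: "?r y \<in> arrows M" "src M (?r y) = tgt M (snd y)" "tgt M (?r y) = tgt M (snd y)" "to_G1 (?r y) = idn C1.G (\<tau> (tgt M (snd y)))"
    if y: "y \<in> topspace ?P" for y
  proof -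
    have [simp]: "to_G1 (ginv M m) = ginv C1.G (to_G1 m)" if "m \<in> arrows M" for m
      using that by (intro C1.G.ginv_unique) (simp_all flip: to_G_cmp)
    show "?r y \<in> arrows M" "src M (?r y) = tgt M (snd y)" "tgt M (?r y) = tgt M (snd y)" "to_G1 (?r y) = idn C1.G (\<tau> (tgt M (snd y)))"
      using P[OF y] by simp_all
  qed
  have c: "continuous_map ?P (Arr M) snd" "continuous_map ?P (Arr C1.H) fst"
    unfolding bd_fibre_product_def N_simps(1) restrict_gpd_simps
    using cont_incl[THEN cont_snd, THEN cont_out] cont_pr1 by auto
  have r_cont: "continuous_map ?P (Arr M) ?r"
    by (intro M.cont_cmp cont_comp[OF _ M.cont_ginv] cont_alpha1 c cont_comp[OF c(1) M.cont_tgt]) (simp_all add: P)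
  have "homeomorphic_maps (Arr (xbun N)) ?P (\<lambda>q. (fst (snd q), bd N q)) (\<lambda>y. (tgt M (snd y), fst y, \<kappa> (?r y)))"
    unfolding homeomorphic_maps_def
  proof (intro conjI ballI)
    show "continuous_map (Arr (xbun N)) ?P (\<lambda>q. (fst (snd q), bd N q))"
      unfolding bd_fibre_product_def
      using morphism_N_bd by (intro cont_into continuous_map_pairedI cont_N_bun[OF cont_id])
        (auto simp: groupoid_morphism_def N_simps(9))
    show "continuous_map ?P (Arr (xbun N)) (\<lambda>y. (tgt M (snd y), fst y, \<kappa> (?r y)))"
      by (intro cont_into_N_bun cont_comp[OF c(1) M.cont_tgt] c cont_comp[OF cont_into[OF r_cont] \<kappa>_cont])
        (use \<kappa> r in \<open>simp_all add: P\<close>)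
  next
    fix q assume "q \<in> arrows (xbun N)"
    then show "(tgt M (snd (fst (snd q), bd N q)), fst (fst (snd q), bd N q), \<kappa> (?r (fst (snd q), bd N q))) = q"
      by (cases q) (simp add: N_simps(9) \<kappa>_left)
  next
    fix y assume y: "y \<in> topspace ?P"
    have "beta1 K (tgt M (snd y), \<kappa> (?r y)) = ?r y"
      using \<kappa>[OF r(1)[OF y]] r[OF y] by simp
    then show "(fst (snd (tgt M (snd y), fst y, \<kappa> (?r y))), bd N (tgt M (snd y), fst y, \<kappa> (?r y))) = y"
      using P[OF y] by (simp add: N_simps(9) prod_eq_iff)
  qed
  then have "homeomorphic_map (Arr (xbun N)) ?P (\<lambda>q. (fst (snd q), bd N q))"
    by (auto simp: homeomorphic_map_maps)
  moreover have "objects M \<inter> S = S"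
    using S by auto
  moreover have "\<exists>m\<in>arrows (xgrp N). tgt (xgrp N) m = x \<and> src (xgrp N) m = y \<and> to_G1 m = g"
    if "x \<in> S" "y \<in> S" "g \<in> arrows C1.G" "tgt C1.G g = \<tau> x" "src C1.G g = \<tau> y" for x y g
    using alpha2_surjective[of x y g] that S by (auto simp: N_simps(1))
  ultimately show ?thesis
    using inj ess img unfolding cartesian_cover_def leg_simps
    by (simp add: N_simps(1) essentially_surjective_iff)
qed

end

theorem theorem4p16:
  fixes C1 :: "('x1, 'g1, 'h1) xmod"
    and C2 :: "('x2, 'g2, 'h2) xmod"
    and K :: "('m0, 'm, 'x1, 'g1, 'h1, 'x2, 'g2, 'h2) crossing_data"
  assumes C1: "groupoid_crossed_module C1"
    and C2: "groupoid_crossed_module C2"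
    and K: "crossing C1 C2 K"
    and nondeg: "topspace (Obj (xgrp C1)) \<noteq> {} \<Longrightarrow> topspace (Obj (xgrp C2)) \<noteq> {}"
  shows "\<exists>(C' :: ('x1 + 'm0, 'g1 + 'm, 'h1 + 'm0 \<times> 'h1 \<times> 'h2) xmod) \<phi> \<psi>.
           groupoid_crossed_module C' \<and>
           xmod_morphism C' C1 \<phi> \<and>
           xmod_morphism C' C2 \<psi> \<and>
           hypercover C' C1 \<phi> \<and>
           weak_homomorphism (assoc_2groupoid C1) (assoc_2groupoid C2)
             (assoc_2groupoid C') (assoc_hom \<phi>) (assoc_hom \<psi>) \<and>
           (essentially_surjective (Obj (mid K)) (tau K) (xgrp C1) \<longrightarrow>
              induced_by_crossing K C' \<phi> \<psi>)"
proof (cases "essentially_surjective (Obj (mid K)) (tau K) (xgrp C1)")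
  case True
  interpret crossing_of C1 C2 K
    by unfold_locales (fact C1 C2 K)+
  \<comment> \<open>One object of the crossing is chosen from each nonempty fibre of \<open>\<tau>\<close>.\<close>
  have "\<tau> ` objects M \<subseteq> \<tau> ` objects M"
    by simp
  then obtain S where S: "S \<subseteq> objects M" "inj_on \<tau> S" "\<tau> ` S = \<tau> ` objects M"
    unfolding subset_image_inj by metis
  interpret crossing_restricted C1 C2 K S
    by unfold_locales
  have inj: "inj (Inr :: 'm0 \<Rightarrow> 'x1 + 'm0)" "inj (Inr :: 'm \<Rightarrow> 'g1 + 'm)"
    "inj (Inr :: 'm0 \<times> 'h1 \<times> 'h2 \<Rightarrow> 'h1 + 'm0 \<times> 'h1 \<times> 'h2)"
    by simp_all
  show ?thesis
    using relabelled_zigzag[OF C1 C2 N_crossed_module leg1_morphism N_cartesian_cover[OF S True]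
        leg2_morphism inj]
      relabel_induced_by_crossing[OF N_crossed_module inj N_induced]
    by metis
next
  case False
  interpret C1: crossed_module C1
    by unfold_locales (fact C1)
  obtain x where x: "topspace (Obj (xgrp C1)) \<noteq> {} \<Longrightarrow> x \<in> topspace (Obj (xgrp C2))"
    using nondeg by (metis ex_in_conv)
  have inj: "inj (Inl :: 'x1 \<Rightarrow> 'x1 + 'm0)" "inj (Inl :: 'g1 \<Rightarrow> 'g1 + 'm)"
    "inj (Inl :: 'h1 \<Rightarrow> 'h1 + 'm0 \<times> 'h1 \<times> 'h2)"
    by simp_all
  show ?thesis
    using False relabelled_zigzag[OF C1 C2 C1 C1.identity_cartesian_cover
        constant_xmod_morphism[OF C1 C2 x] inj]
    by metis
qed

end
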